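(* Let $g\ge 1$ be an integer. For any $x,y\in\mathbb{C}^g$ with $\|x\|_2<1$ and $\|y\|_2<1$, $$\lim_{d\to\infty}\int_{U(d)^g}\det\Big(I_d+\sum_{j=1}^g x_jU_j\Big)\,\overline{\det\Big(I_d+\sum_{j=1}^g y_jU_j\Big)}\,d\mathcal{U}=\frac{1}{1-\langle x,y\rangle}.$$
   Context: $U(d)$ is the group of $d\times d$ complex unitary matrices with its normalized Haar probability measure, and $d\mathcal{U}=dU_1\times\cdots\times dU_g$ is the product measure on $U(d)^g$, $\mathcal{U}=(U_1,\dots,U_g)$. $\langle x,y\rangle=\sum_{j=1}^g x_j\overline{y_j}$ and $\|\cdot\|_2$ are the usual Euclidean inner product and norm on $\mathbb{C}^g$. *)

theory Defs
  imports
    "HOL-Probability.Probability"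
    "Jordan_Normal_Form.Schur_Decomposition"
begin

(* "$" is kept for the components of vectors in complex ^ 'g. *)
no_notation Matrix.vec_index (infixl "$" 100)

definition unitary_group :: "nat \<Rightarrow> complex mat set" where
  "unitary_group d = {U \<in> carrier_mat d d. mat_adjoint U * U = 1\<^sub>m d}"

definition entries :: "nat \<Rightarrow> complex mat \<Rightarrow> nat \<times> nat \<Rightarrow> complex" where
  "entries d U = (\<lambda>(i, k). if i < d \<and> k < d then U $$ (i, k) else 0)"

(* The type of matrices carries no topology. U(d) has the topology induced by the injection
   "entries d" into a product of copies of the complex plane, so its Borel sets are exactly
   the preimages of Borel sets under this map. *)
definition borel_unitary :: "nat \<Rightarrow> complex mat measure" where
  "borel_unitary d = vimage_algebra (unitary_group d) (entries d) borel"

(* U(d) is a compact group, so exactly one measure satisfies this predicate. Left multiplication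
   by V is continuous, hence measurable, so the image measure is the genuine one. *)
definition haar_prob :: "nat \<Rightarrow> complex mat measure \<Rightarrow> bool" where
  "haar_prob d M \<longleftrightarrow>
     sets M = sets (borel_unitary d) \<and> prob_space M \<and>
     (\<forall>V\<in>unitary_group d. distr M M (\<lambda>U. V * U) = M)"

definition cinner :: "complex ^ 'g \<Rightarrow> complex ^ 'g \<Rightarrow> complex" where
  "cinner x y = (\<Sum>j\<in>UNIV. x $ j * cnj (y $ j))"

definition linear_pencil :: "nat \<Rightarrow> complex ^ 'g \<Rightarrow> ('g \<Rightarrow> complex mat) \<Rightarrow> complex mat" where
  "linear_pencil d x U = 1\<^sub>m d + mat d d (\<lambda>(i, k). \<Sum>j\<in>UNIV. x $ j * U j $$ (i, k))"

end

theory Submission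
  imports Defs "HOL-Real_Asymp.Real_Asymp"
begin

text \<open>
  For a single Haar unitary \<open>U\<close> of size \<open>d\<close>, left invariance alone makes the minors \<open>U[S, T]\<close> orthogonal,
  with second moment \<open>1 / (d choose m)\<close> for \<open>m = card S = card T\<close>. Expand the minors of
  \<open>A + x\<^sub>j U\<^sub>j\<close> by Laplace and integrate out one \<open>U\<^sub>j\<close> after the other: the minors of
  \<open>X = x\<^sub>1 U\<^sub>1 + \<dots> + x\<^sub>g U\<^sub>g\<close> and \<open>Y = y\<^sub>1 U\<^sub>1 + \<dots> + y\<^sub>g U\<^sub>g\<close> are again orthogonal, and their
  mixed moment \<open>c(d, m)\<close> depends on \<open>d\<close> and the size \<open>m\<close> only. Since \<open>det (1 + X)\<close> is the sum of all
  principal minors of \<open>X\<close>, the integral equals the sum of \<open>(d choose m) c(d, m)\<close> over \<open>m \<le> d\<close>. As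
  \<open>d\<close> tends to infinity, the \<open>m\<close>-th term tends to the \<open>m\<close>-th power of \<open>\<langle>x, y\<rangle>\<close>, and it is dominated by
  the \<open>m\<close>-th power of the sum of the \<open>\<bar>x\<^sub>j y\<^sub>j\<bar>\<close>, which is less than 1, so Tannery's theorem applies.
\<close>

section \<open>Signs of inversions\<close>

text \<open>Monotonicity on \<open>e\<close> depends on the unordered pair only, so inversions can
  be collected over two-element subsets without first ordering their elements.\<close>

definition pair_sign :: "(nat \<Rightarrow> nat) \<Rightarrow> nat set \<Rightarrow> int" where
  "pair_sign p e = (if mono_on e p then 1 else -1)"

text \<open>For an injective \<open>p\<close> this is -1 to the number of inversions. The image of
  \<open>S\<close> may be a different set, since the row and column sets of a minor differ in
  general; on permutations it is the usual sign.\<close>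

definition inversion_sign :: "nat set \<Rightarrow> (nat \<Rightarrow> nat) \<Rightarrow> int" where
  "inversion_sign S p = (\<Prod>e\<in>{e. e \<subseteq> S \<and> card e = 2}. pair_sign p e)"

definition less_sign :: "nat \<Rightarrow> nat \<Rightarrow> int" where
  "less_sign a b = (if a < b then 1 else -1)"

text \<open>For disjoint \<open>R\<close> and \<open>P\<close> this is the sign of the shuffle that
  lists \<open>R\<close> in increasing order and then \<open>P\<close> in increasing order, the sign
  known from the Laplace expansion.\<close>

definition shuffle_sign :: "nat set \<Rightarrow> nat set \<Rightarrow> int" where
  "shuffle_sign R P = (\<Prod>a\<in>R. \<Prod>b\<in>P. less_sign a b)"

lemma card_2_lessE:
  fixes e :: "nat set"
  assumes "card e = 2"
  obtains a b where "a < b" "e = {a, b}"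
  using assms by (metis card_2_iff insert_commute linorder_neqE_nat)

lemma pair_sign_doubleton:
  "a < b \<Longrightarrow> pair_sign p {a, b} = (if p a \<le> p b then 1 else -1)"
  by (auto simp: pair_sign_def mono_on_def)

lemma pair_sign_square [simp]: "pair_sign p e * pair_sign p e = 1"
  by (simp add: pair_sign_def)

lemma less_sign_square [simp]: "less_sign a b * less_sign a b = 1"
  by (simp add: less_sign_def)

text \<open>Exchanging \<open>a\<close> and \<open>b\<close> flips both factors on the right, so
  this form avoids any assumption on which of the two is smaller.\<close>

lemma pair_sign_less_sign:
  assumes "a \<noteq> b" "p a \<noteq> p b"
  shows "pair_sign p {a, b} = less_sign a b * less_sign (p a) (p b)"
proof (cases "a < b")
  case True
  then show ?thesis using assms by (auto simp: pair_sign_doubleton less_sign_def)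
next
  case False
  then have "b < a" using assms by simp
  then show ?thesis
    using assms pair_sign_doubleton[of b a p] by (auto simp: insert_commute less_sign_def)
qed

text \<open>Written with \<open>less_sign\<close>, the comparison of \<open>p a\<close> with
  \<open>p b\<close> occurs in both factors on the right and squares to 1.\<close>

lemma pair_sign_comp:
  assumes e: "card e = 2" and p: "inj_on p e" and q: "inj_on q (p ` e)"
  shows "pair_sign (q \<circ> p) e = pair_sign q (p ` e) * pair_sign p e"
proof -
  obtain a b where ab: "a < b" "e = {a, b}" using e by (rule card_2_lessE)
  have "p a \<noteq> p b" using p ab by (auto simp: inj_on_def)
  moreover have "q (p a) \<noteq> q (p b)" using q ab \<open>p a \<noteq> p b\<close> by (auto simp: inj_on_def)
  ultimately show ?thesis
    using ab by (simp add: pair_sign_less_sign)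
qed

text \<open>An injective \<open>p\<close> maps the pairs in \<open>S\<close> bijectively to the
  pairs in its image, so multiplicativity for single pairs can be multiplied up and
  reindexed.\<close>

lemma inversion_sign_comp:
  assumes p: "inj_on p S" and q: "inj_on q (p ` S)"
  shows "inversion_sign S (q \<circ> p) = inversion_sign (p ` S) q * inversion_sign S p"
proof -
  let ?E = "\<lambda>S. {e. e \<subseteq> S \<and> card e = 2}"
  have bij: "bij_betw ((`) p) (?E S) (?E (p ` S))"
  proof (rule bij_betwI')
    fix e e' assume "e \<in> ?E S" "e' \<in> ?E S"
    then show "p ` e = p ` e' \<longleftrightarrow> e = e'" using p by (simp add: inj_on_image_eq_iff)
  next
    fix e assume "e \<in> ?E S"
    then show "p ` e \<in> ?E (p ` S)" using p by (auto simp: card_image inj_on_subset)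
  next
    fix f assume f: "f \<in> ?E (p ` S)"
    then obtain e where e: "e \<subseteq> S" "f = p ` e" by (auto simp: subset_image_iff)
    then have "card e = 2" using f p by (metis (mono_tags, lifting) card_image inj_on_subset mem_Collect_eq)
    then show "\<exists>e\<in>?E S. f = p ` e" using e by auto
  qed
  have "inversion_sign S (q \<circ> p) = (\<Prod>e\<in>?E S. pair_sign q (p ` e) * pair_sign p e)"
    unfolding inversion_sign_def
    by (intro prod.cong refl pair_sign_comp) (auto intro: inj_on_subset[OF p] inj_on_subset[OF q])
  also have "\<dots> = (\<Prod>e\<in>?E S. pair_sign q (p ` e)) * (\<Prod>e\<in>?E S. pair_sign p e)"
    by (rule prod.distrib)
  also have "(\<Prod>e\<in>?E S. pair_sign q (p ` e)) = (\<Prod>e\<in>?E (p ` S). pair_sign q e)"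
    by (rule prod.reindex_bij_betw[OF bij])
  finally show ?thesis unfolding inversion_sign_def .
qed

lemma inversion_sign_cong:
  assumes "\<And>i. i \<in> S \<Longrightarrow> p i = q i"
  shows "inversion_sign S p = inversion_sign S q"
  unfolding inversion_sign_def
proof (rule prod.cong[OF refl])
  fix e assume "e \<in> {e. e \<subseteq> S \<and> card e = 2}"
  then have "\<And>i. i \<in> e \<Longrightarrow> p i = q i" using assms by auto
  then show "pair_sign p e = pair_sign q e" by (simp add: pair_sign_def mono_on_def)
qed

lemma inversion_sign_square [simp]: "inversion_sign S p * inversion_sign S p = 1"
  by (simp add: inversion_sign_def flip: prod.distrib)

lemma shuffle_sign_square [simp]: "shuffle_sign R P * shuffle_sign R P = 1"
  by (simp add: shuffle_sign_def flip: prod.distrib)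

lemma inversion_sign_ident [simp]: "inversion_sign S (\<lambda>i. i) = 1"
  by (simp add: inversion_sign_def pair_sign_def mono_on_def)

lemma inversion_sign_id [simp]: "inversion_sign S id = 1"
  by (simp add: inversion_sign_def pair_sign_def mono_on_def)

text \<open>A pair in \<open>S\<close> lies inside \<open>R\<close>, inside \<open>S - R\<close>, or
  meets both. The crossing pairs see \<open>p\<close> only through the images of the two blocks;
  this is what makes the Laplace expansion factor.\<close>

lemma inversion_sign_split:
  assumes fin: "finite S" and R: "R \<subseteq> S" and p: "inj_on p S"
  shows "inversion_sign S p = inversion_sign R p * inversion_sign (S - R) p *
           (shuffle_sign R (S - R) * shuffle_sign (p ` R) (p ` (S - R)))"
proof -
  let ?E = "\<lambda>S. {e. e \<subseteq> S \<and> card e = 2}"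
  let ?c = "\<lambda>(a, b). {a, b}"
  have E: "?E S = (?E R \<union> ?E (S - R)) \<union> ?c ` (R \<times> (S - R))" (is "?lhs = ?rhs")
  proof
    show "?lhs \<subseteq> ?rhs"
    proof
      fix e assume e: "e \<in> ?lhs"
      then obtain a b where ab: "a \<noteq> b" "e = {a, b}" "a \<in> S" "b \<in> S"
        by (auto simp: card_2_iff)
      have "a \<in> R \<Longrightarrow> b \<notin> R \<Longrightarrow> e \<in> ?c ` (R \<times> (S - R))"
        using ab by (intro image_eqI[where x = "(a, b)"]) auto
      moreover have "a \<notin> R \<Longrightarrow> b \<in> R \<Longrightarrow> e \<in> ?c ` (R \<times> (S - R))"
        using ab by (intro image_eqI[where x = "(b, a)"]) auto
      ultimately show "e \<in> ?rhs" using ab by auto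
    qed
    show "?rhs \<subseteq> ?lhs" using R by (auto simp: card_2_iff)
  qed
  have finE: "finite (?E A)" if "A \<subseteq> S" for A
    using finite_subset[OF that fin] by simp
  have inj: "inj_on ?c (R \<times> (S - R))"
    by (auto simp: inj_on_def doubleton_eq_iff)
  have "inversion_sign S p = inversion_sign R p * inversion_sign (S - R) p *
      prod (pair_sign p) (?c ` (R \<times> (S - R)))"
    unfolding inversion_sign_def E
  proof (subst prod.union_disjoint)
    show "(?E R \<union> ?E (S - R)) \<inter> ?c ` (R \<times> (S - R)) = {}" by auto
    have "?E R \<inter> ?E (S - R) = {}"
      by (auto simp: card_2_iff)
    then show "prod (pair_sign p) (?E R \<union> ?E (S - R)) * prod (pair_sign p) (?c ` (R \<times> (S - R))) =
      prod (pair_sign p) (?E R) * prod (pair_sign p) (?E (S - R)) *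
      prod (pair_sign p) (?c ` (R \<times> (S - R)))"
      using finE[OF R] finE[of "S - R"] by (simp add: prod.union_disjoint)
  qed (use finE[OF R] finE[of "S - R"] fin finite_subset[OF R fin] in auto)
  also have "prod (pair_sign p) (?c ` (R \<times> (S - R))) =
      (\<Prod>(a, b)\<in>R \<times> (S - R). less_sign a b * less_sign (p a) (p b))"
  proof (subst prod.reindex[OF inj], rule prod.cong[OF refl])
    fix x assume "x \<in> R \<times> (S - R)"
    then obtain a b where x: "x = (a, b)" "a \<in> R" "b \<in> S - R" by auto
    then have "a \<noteq> b" "p a \<noteq> p b" using p R by (auto dest: inj_onD)
    then show "(pair_sign p \<circ> ?c) x = (case x of (a, b) \<Rightarrow> less_sign a b * less_sign (p a) (p b))"
      using x by (simp add: pair_sign_less_sign)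
  qed
  also have "\<dots> = shuffle_sign R (S - R) * shuffle_sign (p ` R) (p ` (S - R))"
    using inj_on_subset[OF p R] inj_on_subset[OF p, of "S - R"]
    by (simp add: shuffle_sign_def prod.reindex prod.distrib flip: prod.cartesian_product)
  finally show ?thesis .
qed

text \<open>Splitting off \<open>{a, b}\<close>, the transposition maps both blocks to themselves,
  so the two shuffle signs agree and cancel. What remains is the single inverted pair.\<close>

lemma inversion_sign_transpose:
  assumes fin: "finite S" and ab: "a \<in> S" "b \<in> S" "a \<noteq> b"
  shows "inversion_sign S (Transposition.transpose a b) = -1"
proof -
  let ?t = "Transposition.transpose a b"
  have "inversion_sign {a, b} ?t = -1"
  proof -
    have "{e. e \<subseteq> {a, b} \<and> card e = 2} = {{a, b}}"
      using ab by (auto simp: card_2_iff)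
    then show ?thesis
      using ab by (simp add: inversion_sign_def pair_sign_less_sign) (simp add: less_sign_def)
  qed
  moreover have "inversion_sign (S - {a, b}) ?t = 1"
    using inversion_sign_cong[of "S - {a, b}" ?t id] by (auto simp: transpose_def)
  moreover have "?t ` {a, b} = {a, b}" by auto
  moreover have "?t ` (S - {a, b}) = S - {a, b}"
    by (auto simp: transpose_def image_iff)
  moreover have "inj_on ?t S" by (rule inj_on_subset[OF inj_transpose]) simp
  ultimately show ?thesis
    using inversion_sign_split[of S "{a, b}" ?t] fin ab by simp
qed

text \<open>Both sides change sign under composition with a transposition. This ties the minors
  below to the Leibniz formula for the determinant.\<close>

lemma inversion_sign_eq_sign:
  assumes "p permutes S" "finite S"
  shows "inversion_sign S p = sign p"
  using assms
proof (induction rule: permutes_induct)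
  case (swap a b p)
  have "inversion_sign S (Transposition.transpose a b \<circ> p) = - inversion_sign S p"
    using swap assms(2) inversion_sign_transpose[of S a b]
      inversion_sign_comp[of p S "Transposition.transpose a b"]
    by (simp add: permutes_image permutes_inj_on inj_on_subset[OF inj_transpose])
  moreover have "sign (Transposition.transpose a b \<circ> p) = - sign p"
    using swap assms(2) permutation_permutes
    by (subst sign_compose) (auto simp: sign_swap_id permutation_swap_id)
  ultimately show ?case using swap by (simp only:)
qed simp

section \<open>Minors indexed by sets\<close>

lemma eq_neg_self_imp_zero:
  fixes a :: "'a::{idom, ring_char_0}"
  assumes "a = - a"
  shows "a = 0"
proof -
  have "2 * a = 0" using iffD1[OF eq_neg_iff_add_eq_0 assms] by (simp only: mult_2)
  then show ?thesis by simp
qed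

text \<open>Extensionality outside \<open>S\<close> lets every bijection be counted exactly once and
  makes the set finite for finite \<open>S\<close> and \<open>T\<close>.\<close>

definition bijections :: "nat set \<Rightarrow> nat set \<Rightarrow> (nat \<Rightarrow> nat) set" where
  "bijections S T = {p \<in> S \<rightarrow>\<^sub>E T. bij_betw p S T}"

text \<open>The Leibniz sum is taken directly over the row set and the column set, so no submatrix
  has to be formed and nothing is renumbered. It vanishes when the two sets differ in size.\<close>

definition minor :: "(nat \<Rightarrow> nat \<Rightarrow> 'a::comm_ring_1) \<Rightarrow> nat set \<Rightarrow> nat set \<Rightarrow> 'a" where
  "minor A S T = (\<Sum>p\<in>bijections S T. of_int (inversion_sign S p) * (\<Prod>i\<in>S. A i (p i)))"

lemma bijections_eq:
  "bijections S T = {p. p \<in> extensional S \<and> inj_on p S \<and> p ` S = T}"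
  by (auto simp: bijections_def bij_betw_def PiE_def)

lemma finite_bijections:
  assumes "finite S" "finite T"
  shows "finite (bijections S T)"
  using assms by (intro finite_subset[OF _ finite_PiE[of S "\<lambda>_. T"]]) (auto simp: bijections_def)

lemma bijections_card_neq: "card S \<noteq> card T \<Longrightarrow> bijections S T = {}"
  by (auto simp: bijections_def dest: bij_betw_same_card)

lemma minor_card_neq: "card S \<noteq> card T \<Longrightarrow> minor A S T = 0"
  by (simp add: minor_def bijections_card_neq)

lemma minor_cong:
  assumes "\<And>i k. i \<in> S \<Longrightarrow> k \<in> T \<Longrightarrow> A i k = B i k"
  shows "minor A S T = minor B S T"
  unfolding minor_def
proof (rule sum.cong[OF refl])
  fix p assume "p \<in> bijections S T"
  then have "(\<Prod>i\<in>S. A i (p i)) = (\<Prod>i\<in>S. B i (p i))"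
    by (intro prod.cong refl assms) (auto simp: bijections_eq)
  then show "of_int (inversion_sign S p) * (\<Prod>i\<in>S. A i (p i)) =
      of_int (inversion_sign S p) * (\<Prod>i\<in>S. B i (p i))" by simp
qed

lemma minor_empty [simp]: "minor A {} {} = 1"
  
proof -
  have "bijections {} {} = {\<lambda>_. undefined}" by (auto simp: bijections_eq)
  moreover have "{e::nat set. e \<subseteq> {} \<and> card e = 2} = {}" by auto
  ultimately show ?thesis by (simp only: minor_def inversion_sign_def) simp
qed

lemma minor_scale: "minor (\<lambda>i k. c * A i k) S T = c ^ card S * minor A S T"
  by (simp add: minor_def sum_distrib_left prod.distrib mult.left_commute)

lemma cnj_minor: "cnj (minor A S T) = minor (\<lambda>i k. cnj (A i k)) S T"
  by (simp add: minor_def)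

lemma minor_permute_rows:
  assumes p: "inj_on p S"
  shows "minor (\<lambda>i. A (p i)) S T = of_int (inversion_sign S p) * minor A (p ` S) T"
proof -
  have "minor (\<lambda>i. A (p i)) S T =
     (\<Sum>q\<in>bijections (p ` S) T. of_int (inversion_sign S (q \<circ> p)) * (\<Prod>i\<in>S. A (p i) (q (p i))))"
    unfolding minor_def
  proof (rule sum.reindex_bij_witness[where
        i = "\<lambda>q. restrict (q \<circ> p) S" and j = "\<lambda>r. restrict (r \<circ> inv_into S p) (p ` S)"])
    fix r assume r: "r \<in> bijections S T"
    show "restrict (restrict (r \<circ> inv_into S p) (p ` S) \<circ> p) S = r"
      using r p by (auto simp: fun_eq_iff bijections_eq extensional_def)
    have "inj_on (r \<circ> inv_into S p) (p ` S)"
      using r p by (intro comp_inj_on) (auto simp: bijections_eq inj_on_inv_into)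
    moreover have "(r \<circ> inv_into S p) ` (p ` S) = T"
      using r p by (auto simp: bijections_eq image_iff)
    ultimately show "restrict (r \<circ> inv_into S p) (p ` S) \<in> bijections (p ` S) T"
      by (simp add: bijections_eq)
    have "inversion_sign S (restrict (r \<circ> inv_into S p) (p ` S) \<circ> p) = inversion_sign S r"
      by (rule inversion_sign_cong) (use p in auto)
    then show "of_int (inversion_sign S (restrict (r \<circ> inv_into S p) (p ` S) \<circ> p)) *
        (\<Prod>i\<in>S. A (p i) (restrict (r \<circ> inv_into S p) (p ` S) (p i))) =
        of_int (inversion_sign S r) * (\<Prod>i\<in>S. A (p i) (r i))"
      using p by (auto intro!: prod.cong)
  next
    fix q assume q: "q \<in> bijections (p ` S) T"
    show "restrict (restrict (q \<circ> p) S \<circ> inv_into S p) (p ` S) = q"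
      using q p by (auto simp: fun_eq_iff bijections_eq extensional_def)
    show "restrict (q \<circ> p) S \<in> bijections S T"
      using q p by (auto simp: bijections_eq comp_inj_on image_comp)
  qed
  also have "\<dots> = of_int (inversion_sign S p) * minor A (p ` S) T"
    unfolding minor_def sum_distrib_left
  proof (rule sum.cong[OF refl])
    fix q assume "q \<in> bijections (p ` S) T"
    then have "inversion_sign S (q \<circ> p) = inversion_sign (p ` S) q * inversion_sign S p"
      using p by (intro inversion_sign_comp) (auto simp: bijections_eq)
    then show "of_int (inversion_sign S (q \<circ> p)) * (\<Prod>i\<in>S. A (p i) (q (p i))) =
      of_int (inversion_sign S p) * (of_int (inversion_sign (p ` S) q) * (\<Prod>i\<in>p ` S. A i (q i)))"
      using p by (simp add: prod.reindex mult_ac)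
  qed
  finally show ?thesis .
qed

text \<open>Exchanging the two equal rows only shows that twice the minor is zero, hence the assumption
  on the characteristic.\<close>

lemma minor_eq_rows:
  fixes A :: "nat \<Rightarrow> nat \<Rightarrow> 'a::{idom, ring_char_0}"
  assumes fin: "finite S" and ab: "a \<in> S" "b \<in> S" "a \<noteq> b" and eq: "A a = A b"
  shows "minor A S T = 0"
proof -
  let ?t = "Transposition.transpose a b"
  have t: "?t permutes S" using ab by (simp add: permutes_swap_id)
  have "(\<lambda>i. A (?t i)) = A"
  proof
    fix i
    show "A (?t i) = A i"
      using eq by (cases "i = a"; cases "i = b") (simp_all only: transpose_apply_first transpose_apply_second transpose_apply_other not_False_eq_True)
  qed
  then have "minor A S T = minor (\<lambda>i. A (?t i)) S T" by (rule arg_cong[OF sym])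
  also have "\<dots> = of_int (inversion_sign S ?t) * minor A (?t ` S) T"
    using t by (intro minor_permute_rows permutes_inj_on)
  also have "\<dots> = - minor A S T"
    unfolding permutes_image[OF t] inversion_sign_transpose[OF fin ab] by simp
  finally show ?thesis by (rule eq_neg_self_imp_zero)
qed

text \<open>Each bijection is paired with its inverse. The two signs are equal because their product
  is the sign of the identity.\<close>

lemma minor_transpose: "minor (\<lambda>i k. A k i) S T = minor A T S"
  unfolding minor_def
proof (rule sum.reindex_bij_witness[where
      i = "\<lambda>q. restrict (inv_into T q) S" and j = "\<lambda>p. restrict (inv_into S p) T"])
  fix p assume p: "p \<in> bijections S T"
  then have bij: "inj_on p S" "p ` S = T" "p \<in> extensional S" by (auto simp: bijections_eq)
  let ?q = "restrict (inv_into S p) T"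
  have q: "inj_on ?q T" "?q ` T = S"
    using bij by (auto simp: inj_on_def image_iff inv_into_into inj_on_inv_into)
  then show "?q \<in> bijections T S" by (auto simp: bijections_eq)
  show "restrict (inv_into T ?q) S = p"
  proof
    fix i show "restrict (inv_into T ?q) S i = p i"
    proof (cases "i \<in> S")
      case True
      then have "?q (p i) = i" "p i \<in> T" using bij by auto
      then have "inv_into T ?q i = p i" using q(1) inv_into_f_eq by metis
      then show ?thesis using True by simp
    qed (use bij in \<open>auto simp: extensional_def\<close>)
  qed
  have "1 = inversion_sign S (?q \<circ> p)"
    using inversion_sign_cong[of S "?q \<circ> p" id] bij by auto
  also have "\<dots> = inversion_sign T ?q * inversion_sign S p"
    using bij q inversion_sign_comp[of p S ?q] by simp
  finally have "inversion_sign T ?q = inversion_sign S p"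
    by (metis inversion_sign_square mult.left_neutral mult.assoc mult.right_neutral)
  moreover have "(\<Prod>k\<in>T. A k (?q k)) = (\<Prod>i\<in>S. A (p i) i)"
    using bij by (intro prod.reindex_cong[OF bij(1)]) auto
  ultimately show "of_int (inversion_sign T ?q) * (\<Prod>k\<in>T. A k (?q k)) =
      of_int (inversion_sign S p) * (\<Prod>i\<in>S. A (p i) i)" by simp
next
  fix q assume p: "q \<in> bijections T S"
  then have bij: "inj_on q T" "q ` T = S" "q \<in> extensional T" by (auto simp: bijections_eq)
  let ?p = "restrict (inv_into T q) S"
  have q: "inj_on ?p S" "?p ` S = T"
    using bij by (auto simp: inj_on_def image_iff inv_into_into inj_on_inv_into)
  then show "?p \<in> bijections S T" by (auto simp: bijections_eq)
  show "restrict (inv_into S ?p) T = q"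
  proof
    fix i show "restrict (inv_into S ?p) T i = q i"
    proof (cases "i \<in> T")
      case True
      then have "?p (q i) = i" "q i \<in> S" using bij by auto
      then have "inv_into S ?p i = q i" using q(1) inv_into_f_eq by metis
      then show ?thesis using True by simp
    qed (use bij in \<open>auto simp: extensional_def\<close>)
  qed
qed

text \<open>A Leibniz term survives only if its bijection fixes every row, which forces
  \<open>S = T\<close>.\<close>

lemma minor_identity:
  assumes "finite S"
  shows "minor (\<lambda>i k. if i = k then 1 else 0) S T = (if S = T then 1 else 0)"
proof -
  have summand: "of_int (inversion_sign S p) * (\<Prod>i\<in>S. if i = p i then 1 else 0) =
      (if p = restrict id S then 1 else (0::'a))" if "p \<in> extensional S" for p
  proof (cases "p = restrict id S")
    case True
    then show ?thesis using inversion_sign_cong[of S p id] by simp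
  next
    case False
    moreover have "p = restrict id S" if "\<forall>i\<in>S. p i = i"
      using that \<open>p \<in> extensional S\<close> by (auto simp: fun_eq_iff extensional_def)
    ultimately obtain i where i: "i \<in> S" "i \<noteq> p i" by metis
    from i(2) have "(if i = p i then 1 else (0::'a)) = 0" by (rule if_not_P)
    then have "(\<Prod>i\<in>S. if i = p i then 1 else (0::'a)) = 0"
      by (rule prod_zero[OF assms bexI[OF _ i(1)]])
    then show ?thesis using False by (simp only: mult_zero_right if_False)
  qed
  show ?thesis
  proof (cases "S = T")
    case True
    have fin: "finite (bijections S S)" using assms by (simp add: finite_bijections)
    have "restrict id S \<in> bijections S S" by (auto simp: bijections_eq)
    moreover have "minor (\<lambda>i k. if i = k then 1 else 0) S S =
        (\<Sum>p\<in>bijections S S. if p = restrict id S then 1 else (0::'a))"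
      unfolding minor_def by (intro sum.cong refl summand) (auto simp: bijections_eq)
    ultimately show ?thesis using True fin by simp
  next
    case False
    have "minor (\<lambda>i k. if i = k then 1 else 0) S T = (\<Sum>p\<in>bijections S T. (0::'a))"
      unfolding minor_def
    proof (rule sum.cong[OF refl])
      fix p assume p: "p \<in> bijections S T"
      then have "p \<noteq> restrict id S" using False by (auto simp: bijections_eq)
      then show "of_int (inversion_sign S p) * (\<Prod>i\<in>S. if i = p i then 1 else 0) = (0::'a)"
        using summand[of p] p by (simp add: bijections_eq)
    qed
    then show ?thesis using False by simp
  qed
qed

text \<open>This is the minor of a pencil without any matrices: the empty product leaves the value 1
  for empty index sets.\<close>

lemma minor_zero:
  assumes "finite S" "card S = card T" "finite T"
  shows "minor (\<lambda>i k. 0) S T = (if S = {} \<and> T = {} then 1 else 0)"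
proof (cases "S = {}")
  case False
  then have "(\<Prod>i\<in>S. 0) = (0::'a)" by (intro prod_zero assms) auto
  then show ?thesis using False by (simp add: minor_def)
qed (use assms in auto)

text \<open>A bijection from \<open>S\<close> onto \<open>T\<close> splits into one from \<open>R\<close> onto \<open>Q\<close> and one between the
  complements; the inversions across the splitting only depend on \<open>R\<close> and \<open>Q\<close>.\<close>

lemma minor_add:
  assumes fin: "finite S" "finite T"
  shows "minor (\<lambda>i k. A i k + B i k) S T =
    (\<Sum>R\<in>Pow S. \<Sum>Q\<in>Pow T. of_int (shuffle_sign R (S - R) * shuffle_sign Q (T - Q)) *
       minor A R Q * minor B (S - R) (T - Q))"
proof -
  let ?g = "\<lambda>R p. of_int (inversion_sign S p) * ((\<Prod>i\<in>R. A i (p i)) * (\<Prod>i\<in>S - R. B i (p i)))"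
  \<comment> \<open>Multiplying out takes each row from \<open>A\<close> or from \<open>B\<close>;
    \<open>R\<close> is the set of rows taken from \<open>A\<close>.\<close>
  have "minor (\<lambda>i k. A i k + B i k) S T = (\<Sum>R\<in>Pow S. \<Sum>p\<in>bijections S T. ?g R p)"
    unfolding minor_def prod_add[OF fin(1)] sum_distrib_left
    by (rule sum.swap)
  also have "\<dots> = (\<Sum>R\<in>Pow S. \<Sum>Q\<in>Pow T.
      of_int (shuffle_sign R (S - R) * shuffle_sign Q (T - Q)) *
       minor A R Q * minor B (S - R) (T - Q))"
  proof (rule sum.cong[OF refl])
    fix R assume "R \<in> Pow S"
    then have R: "R \<subseteq> S" by simp
    have finR: "finite R" using R fin finite_subset by auto
    let ?I = "SIGMA Q : Pow T. bijections R Q \<times> bijections (S - R) (T - Q)"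
    let ?f = "\<lambda>(Q, q, r). (of_int (inversion_sign R q) * (\<Prod>i\<in>R. A i (q i))) *
        (of_int (inversion_sign (S - R) r) * (\<Prod>i\<in>S - R. B i (r i))) *
        of_int (shuffle_sign R (S - R) * shuffle_sign Q (T - Q))"
    \<comment> \<open>For fixed \<open>R\<close>, a bijection of \<open>S\<close> onto
      \<open>T\<close> is encoded by the image \<open>Q\<close> of \<open>R\<close> and its
      restrictions to the two blocks.\<close>
    have "(\<Sum>p\<in>bijections S T. ?g R p) = sum ?f ?I"
    proof (rule sum.reindex_bij_witness[where
          j = "\<lambda>p. (p ` R, restrict p R, restrict p (S - R))" and
          i = "\<lambda>(Q, q, r). restrict (\<lambda>i. if i \<in> R then q i else r i) S"])
      fix p assume "p \<in> bijections S T"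
      then have p: "inj_on p S" "p ` S = T" "p \<in> extensional S" by (auto simp: bijections_eq)
      have im: "p ` (S - R) = T - p ` R" using p R inj_on_image_set_diff[of p S S R] by auto
      show "(case (p ` R, restrict p R, restrict p (S - R)) of (Q, q, r) \<Rightarrow>
          restrict (\<lambda>i. if i \<in> R then q i else r i) S) = p"
        using p R by (auto simp: fun_eq_iff extensional_def)
      show "(p ` R, restrict p R, restrict p (S - R)) \<in> ?I"
        using p R im inj_on_subset[OF p(1) R] inj_on_subset[OF p(1), of "S - R"]
        by (auto simp: bijections_eq inj_on_restrict_eq)
      have "inversion_sign R (restrict p R) = inversion_sign R p"
        "inversion_sign (S - R) (restrict p (S - R)) = inversion_sign (S - R) p"
        by (rule inversion_sign_cong, simp)+
      moreover have "(\<Prod>i\<in>R. A i (restrict p R i)) = (\<Prod>i\<in>R. A i (p i))"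
        "(\<Prod>i\<in>S - R. B i (restrict p (S - R) i)) = (\<Prod>i\<in>S - R. B i (p i))"
        by (rule prod.cong; simp)+
      ultimately show "?f (p ` R, restrict p R, restrict p (S - R)) = ?g R p"
        using inversion_sign_split[OF fin(1) R p(1)] im by (simp add: mult_ac)
    next
      fix x assume "x \<in> ?I"
      then obtain Q q r where x: "x = (Q, q, r)" "Q \<subseteq> T" "q \<in> bijections R Q"
        "r \<in> bijections (S - R) (T - Q)" by auto
      then have q: "inj_on q R" "q ` R = Q" "q \<in> extensional R"
        and r: "inj_on r (S - R)" "r ` (S - R) = T - Q" "r \<in> extensional (S - R)"
        by (auto simp: bijections_eq)
      let ?p = "restrict (\<lambda>i. if i \<in> R then q i else r i) S"
      have 1: "restrict ?p R = q" "restrict ?p (S - R) = r"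
        using q(3) r(3) R by (auto simp: fun_eq_iff extensional_def)
      have imR: "?p ` R = Q" using q(2) R by auto
      moreover have imC: "?p ` (S - R) = T - Q" using r(2) by auto
      ultimately have im: "?p ` S = T" using R x(2) by blast
      have "inj_on ?p R" using q(1) R by (auto simp: inj_on_def)
      moreover have "inj_on ?p (S - R)" using r(1) by (auto simp: inj_on_def)
      ultimately have "inj_on ?p (R \<union> (S - R))"
        using imR imC by (subst inj_on_Un) auto
      then have "inj_on ?p S" using R by (simp add: Un_absorb1)
      then show "(case x of (Q, q, r) \<Rightarrow> restrict (\<lambda>i. if i \<in> R then q i else r i) S) \<in> bijections S T"
        using im x(1) by (simp add: bijections_eq)
      show "(\<lambda>p. (p ` R, restrict p R, restrict p (S - R)))
          (case x of (Q, q, r) \<Rightarrow> restrict (\<lambda>i. if i \<in> R then q i else r i) S) = x"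
        using x(1) 1 imR by simp
    qed
    also have "\<dots> = (\<Sum>Q\<in>Pow T. \<Sum>(q, r)\<in>bijections R Q \<times> bijections (S - R) (T - Q). ?f (Q, q, r))"
      using fin finR
      by (subst sum.Sigma)
        (auto simp: split_def intro!: finite_cartesian_product finite_bijections intro: finite_subset)
    also have "\<dots> = (\<Sum>Q\<in>Pow T. of_int (shuffle_sign R (S - R) * shuffle_sign Q (T - Q)) *
       minor A R Q * minor B (S - R) (T - Q))"
      unfolding minor_def sum_product sum.cartesian_product
      by (intro sum.cong refl) (simp add: sum_product sum_distrib_left sum.cartesian_product mult_ac split_def)
    finally show "(\<Sum>p\<in>bijections S T. ?g R p) = \<dots>" .
  qed
  finally show ?thesis .
qed

text \<open>This is the Cauchy--Binet formula. Expanding the products of sums, \<open>g\<close>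
  records the inner index chosen in each row. A non-injective \<open>g\<close> repeats a row of
  \<open>B\<close> and contributes nothing; the injective ones are grouped by their image
  \<open>R\<close>.\<close>

lemma minor_mult:
  fixes A B :: "nat \<Rightarrow> nat \<Rightarrow> 'a::{idom, ring_char_0}"
  assumes fin: "finite S" "finite T" "finite N"
  shows "minor (\<lambda>i k. \<Sum>r\<in>N. A i r * B r k) S T = (\<Sum>R\<in>Pow N. minor A S R * minor B R T)"
proof -
  let ?P = "S \<rightarrow>\<^sub>E N"
  let ?h = "\<lambda>g. (\<Prod>i\<in>S. A i (g i)) * minor (\<lambda>i. B (g i)) S T"
  have finP: "finite ?P" using fin by (intro finite_PiE) auto
  have "minor (\<lambda>i k. \<Sum>r\<in>N. A i r * B r k) S T =
     (\<Sum>p\<in>bijections S T. \<Sum>g\<in>?P. of_int (inversion_sign S p) * (\<Prod>i\<in>S. A i (g i) * B (g i) (p i)))"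
    unfolding minor_def sum_distrib_left[symmetric]
    using fin by (subst prod_sum_PiE) auto
  also have "\<dots> = (\<Sum>g\<in>?P. ?h g)"
    unfolding minor_def sum_distrib_left
    by (subst sum.swap) (simp add: prod.distrib mult_ac)
  also have "\<dots> = (\<Sum>g\<in>{g \<in> ?P. inj_on g S}. ?h g)"
  proof (rule sum.mono_neutral_right[OF finP])
    show "\<forall>g\<in>?P - {g \<in> ?P. inj_on g S}. ?h g = 0"
    proof
      fix g assume "g \<in> ?P - {g \<in> ?P. inj_on g S}"
      then obtain a b where "a \<in> S" "b \<in> S" "a \<noteq> b" "g a = g b" by (auto simp: inj_on_def)
      then have "minor (\<lambda>i. B (g i)) S T = 0"
        using minor_eq_rows[of S a b "\<lambda>i. B (g i)" T] fin by simp
      then show "?h g = 0" by simp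
    qed
  qed auto
  also have "{g \<in> ?P. inj_on g S} = (\<Union>R\<in>Pow N. bijections S R)"
    by (auto simp: bijections_eq PiE_iff)
  also have "(\<Sum>g\<in>(\<Union>R\<in>Pow N. bijections S R). ?h g) = (\<Sum>R\<in>Pow N. \<Sum>g\<in>bijections S R. ?h g)"
    using fin by (intro sum.UNION_disjoint ballI impI finite_bijections) (auto intro: finite_subset simp: bijections_eq)
  also have "\<dots> = (\<Sum>R\<in>Pow N. minor A S R * minor B R T)"
  proof (rule sum.cong[OF refl])
    fix R assume "R \<in> Pow N"
    have "?h g = of_int (inversion_sign S g) * (\<Prod>i\<in>S. A i (g i)) * minor B R T"
      if "g \<in> bijections S R" for g
      using that minor_permute_rows[of g S B T] by (auto simp: bijections_eq mult_ac)
    then show "(\<Sum>g\<in>bijections S R. ?h g) = minor A S R * minor B R T"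
      by (simp only: minor_def[of A] sum_distrib_right cong: sum.cong)
  qed
  finally show ?thesis .
qed

section \<open>Determinants as minors, and a bound for minors\<close>

lemma det_eq_minor:
  assumes "M \<in> carrier_mat n n"
  shows "Determinant.det M = minor (\<lambda>i k. M $$ (i, k)) {..<n} {..<n}"
proof -
  have "Determinant.det M = (\<Sum>p | p permutes {..<n}. of_int (sign p) * (\<Prod>i<n. M $$ (i, p i)))"
    unfolding det_def'[OF assms] by (simp add: atLeast0LessThan)
  also have "\<dots> = minor (\<lambda>i k. M $$ (i, k)) {..<n} {..<n}"
    unfolding minor_def
  \<comment> \<open>The correspondence only changes values outside \<open>{..<n}\<close>:
    permutations are the identity there, members of \<open>bijections\<close> are
    \<open>undefined\<close>.\<close>
  proof (rule sum.reindex_bij_witness[where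
      i = "\<lambda>p i. if i < n then p i else i" and j = "\<lambda>p. restrict p {..<n}"])
    fix p assume "p \<in> {p. p permutes {..<n}}"
    then have p: "p permutes {..<n}" by simp
    show "(\<lambda>i. if i < n then restrict p {..<n} i else i) = p"
      using p by (auto simp: fun_eq_iff permutes_def)
    show "restrict p {..<n} \<in> bijections {..<n} {..<n}"
      using p by (auto simp: bijections_eq inj_on_restrict_eq permutes_inj_on permutes_image)
    have "inversion_sign {..<n} (restrict p {..<n}) = sign p"
      using inversion_sign_eq_sign[OF p] inversion_sign_cong[of "{..<n}" "restrict p {..<n}" p] by simp
    then show "of_int (inversion_sign {..<n} (restrict p {..<n})) *
        (\<Prod>i<n. M $$ (i, restrict p {..<n} i)) = of_int (sign p) * (\<Prod>i<n. M $$ (i, p i))"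
      by simp
  next
    fix p assume p: "p \<in> bijections {..<n} {..<n}"
    then show "restrict (\<lambda>i. if i < n then p i else i) {..<n} = p"
      by (auto simp: fun_eq_iff bijections_eq extensional_def)
    have "bij_betw (\<lambda>i. if i < n then p i else i) {..<n} {..<n}"
      using p by (subst bij_betw_cong[of _ _ p]) (auto simp: bijections_def)
    then show "(\<lambda>i. if i < n then p i else i) \<in> {p. p permutes {..<n}}"
      by (auto intro!: bij_imp_permutes split: if_splits)
  qed
  finally show ?thesis .
qed

text \<open>In the expansion of the sum, the complementary minor of the identity vanishes unless
  \<open>R = Q\<close>, and then the two shuffle signs coincide and cancel.\<close>

lemma minor_add_identity:
  assumes fin: "finite N"
  shows "minor (\<lambda>i k. (if i = k then 1 else 0) + A i k) N N = (\<Sum>S\<in>Pow N. minor A S S)"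
proof -
  have "minor (\<lambda>i k. (if i = k then 1 else 0) + A i k) N N =
    (\<Sum>R\<in>Pow N. \<Sum>Q\<in>Pow N. of_int (shuffle_sign R (N - R) * shuffle_sign Q (N - Q)) *
       minor A R Q * minor (\<lambda>i k. if i = k then 1 else 0) (N - R) (N - Q))"
    using minor_add[OF fin fin, of A "\<lambda>i k. if i = k then 1 else 0"] by (simp add: add.commute)
  also have "\<dots> = (\<Sum>R\<in>Pow N. \<Sum>Q\<in>Pow N. if Q = R then minor A R R else 0)"
  proof (intro sum.cong refl)
    fix R Q assume "R \<in> Pow N" "Q \<in> Pow N"
    then have eq: "N - R = N - Q \<longleftrightarrow> Q = R" by blast
    have id: "minor (\<lambda>i k. if i = k then 1 else (0::'a)) (N - R) (N - Q) = (if Q = R then 1 else 0)"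
      by (subst minor_identity[OF finite_Diff[OF fin]]) (simp only: eq)
    show "of_int (shuffle_sign R (N - R) * shuffle_sign Q (N - Q)) *
       minor A R Q * minor (\<lambda>i k. if i = k then 1 else 0) (N - R) (N - Q) =
       (if Q = R then minor A R R else 0)"
      unfolding id by (cases "Q = R") (simp_all del: of_int_mult)
  qed
  also have "\<dots> = (\<Sum>R\<in>Pow N. minor A R R)" using fin by simp
  finally show ?thesis .
qed

text \<open>A crude termwise bound suffices, since it only serves to make products of minors bounded
  and hence integrable.\<close>

lemma norm_minor_le:
  fixes A :: "nat \<Rightarrow> nat \<Rightarrow> complex" and K :: real
  assumes "\<And>i k. i \<in> S \<Longrightarrow> k \<in> T \<Longrightarrow> norm (A i k) \<le> K"
  shows "norm (minor A S T) \<le> card (bijections S T) * K ^ card S"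
  unfolding minor_def
proof (rule sum_norm_bound)
  fix p assume p: "p \<in> bijections S T"
  have "inversion_sign S p = 1 \<or> inversion_sign S p = -1"
    using inversion_sign_square[of S p] by (rule square_eq_1_iff[THEN iffD1])
  then have "norm (of_int (inversion_sign S p) :: complex) = 1"
    by (rule disjE) (simp_all only: of_int_minus of_int_1 norm_minus_cancel norm_one)
  then have "norm (of_int (inversion_sign S p) * (\<Prod>i\<in>S. A i (p i))) = (\<Prod>i\<in>S. norm (A i (p i)))"
    by (simp only: norm_mult prod_norm mult_1)
  also have "\<dots> \<le> (\<Prod>i\<in>S. K)"
  proof (rule prod_mono)
    fix i assume i: "i \<in> S"
    then have "p i \<in> T" using p by (auto simp: bijections_eq)
    then show "0 \<le> norm (A i (p i)) \<and> norm (A i (p i)) \<le> K" using assms[OF i] by simp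
  qed
  finally show "norm (of_int (inversion_sign S p) * (\<Prod>i\<in>S. A i (p i))) \<le> K ^ card S"
    by (simp only: prod_constant)
qed

section \<open>Minors of Haar unitary matrices\<close>

lemma mat_adjoint_index:
  "A \<in> carrier_mat n m \<Longrightarrow> i < m \<Longrightarrow> j < n \<Longrightarrow> mat_adjoint A $$ (i, j) = cnj (A $$ (j, i))"
  by (simp add: mat_adjoint_def mat_of_rows_index conjugate_complex_def)

text \<open>Orthonormality of the columns, written as sums over entries, is the form to which the
  Cauchy--Binet formula applies.\<close>

lemma unitary_group_iff:
  "U \<in> unitary_group d \<longleftrightarrow> U \<in> carrier_mat d d \<and>
     (\<forall>i<d. \<forall>k<d. (\<Sum>r<d. cnj (U $$ (r, i)) * U $$ (r, k)) = (if i = k then 1 else 0))"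
proof (cases "U \<in> carrier_mat d d")
  case True
  have dims: "dim_row (mat_adjoint U) = d" "dim_col (mat_adjoint U) = d"
    using True by (auto simp: mat_adjoint_def)
  have "(mat_adjoint U * U) $$ (i, k) = (\<Sum>r<d. cnj (U $$ (r, i)) * U $$ (r, k))"
    if "i < d" "k < d" for i k
    using that True dims
    by (auto simp: scalar_prod_def mat_adjoint_index[OF True] atLeast0LessThan intro!: sum.cong)
  then show ?thesis
    using True dims by (auto simp: unitary_group_def mat_eq_iff)
qed (simp add: unitary_group_def)

lemma unitary_group_entry_le_1:
  assumes U: "U \<in> unitary_group d" and ik: "i < d" "k < d"
  shows "norm (U $$ (i, k)) \<le> 1"
proof -
  have "(\<Sum>r<d. cnj (U $$ (r, k)) * U $$ (r, k)) = 1"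
    using U ik by (auto simp: unitary_group_iff)
  then have "(\<Sum>r<d. complex_of_real ((norm (U $$ (r, k)))\<^sup>2)) = 1"
    by (simp only: complex_norm_square mult.commute[of "cnj _"])
  then have "(\<Sum>r<d. (norm (U $$ (r, k)))\<^sup>2) = 1"
    by (simp only: of_real_sum[symmetric] of_real_eq_1_iff)
  moreover have "(norm (U $$ (i, k)))\<^sup>2 \<le> (\<Sum>r<d. (norm (U $$ (r, k)))\<^sup>2)"
    using ik by (intro member_le_sum) auto
  ultimately show ?thesis by (simp add: power_le_one_iff)
qed

text \<open>Left multiplication replaces row \<open>i\<close> by \<open>c i\<close> times row
  \<open>p i\<close>. This covers diagonal matrices (\<open>p = id\<close>) and permutation matrices
  (\<open>c\<close> constantly 1) at once, the only translations by which invariance is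
  exploited.\<close>

definition monomial_mat :: "nat \<Rightarrow> (nat \<Rightarrow> nat) \<Rightarrow> (nat \<Rightarrow> complex) \<Rightarrow> complex mat" where
  "monomial_mat d p c = mat d d (\<lambda>(i, k). if k = p i then c i else 0)"

lemma monomial_mat_carrier: "monomial_mat d p c \<in> carrier_mat d d"
  by (simp add: monomial_mat_def)

lemma monomial_mat_mult_index:
  assumes "p permutes {..<d}" "U \<in> carrier_mat d d" "i < d" "k < d"
  shows "(monomial_mat d p c * U) $$ (i, k) = c i * U $$ (p i, k)"
proof -
  have "p i < d" using assms by (metis lessThan_iff permutes_in_image)
  have "(monomial_mat d p c * U) $$ (i, k) = (\<Sum>r<d. (if r = p i then c i else 0) * U $$ (r, k))"
    using assms by (simp add: monomial_mat_def scalar_prod_def atLeast0LessThan)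
  also have "\<dots> = (\<Sum>r<d. if r = p i then c i * U $$ (r, k) else 0)"
    by (intro sum.cong) auto
  finally show ?thesis using \<open>p i < d\<close> by simp
qed

text \<open>In the inner product of two columns the unimodular factors cancel and \<open>p\<close>
  merely reorders the sum. Unitarity of the monomial matrix itself is then the case
  \<open>U = 1\<close>.\<close>

lemma monomial_mat_mult_unitary:
  assumes p: "p permutes {..<d}" and c: "\<And>i. i < d \<Longrightarrow> norm (c i) = 1" and U: "U \<in> unitary_group d"
  shows "monomial_mat d p c * U \<in> unitary_group d"
proof -
  have Uc: "U \<in> carrier_mat d d" using U by (simp add: unitary_group_def)
  have c1: "cnj (c i) * c i = 1" if "i < d" for i
    using c[OF that] complex_norm_square[of "c i"] by (simp add: mult.commute)
  have "(\<Sum>r<d. cnj ((monomial_mat d p c * U) $$ (r, i)) * (monomial_mat d p c * U) $$ (r, k)) =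
      (\<Sum>r<d. cnj (U $$ (r, i)) * U $$ (r, k))" if "i < d" "k < d" for i k
  proof -
    have "(\<Sum>r<d. cnj ((monomial_mat d p c * U) $$ (r, i)) * (monomial_mat d p c * U) $$ (r, k)) =
      (\<Sum>r<d. (cnj (c r) * c r) * (cnj (U $$ (p r, i)) * U $$ (p r, k)))"
      using that by (intro sum.cong) (simp_all add: monomial_mat_mult_index[OF p Uc])
    also have "\<dots> = (\<Sum>r<d. cnj (U $$ (p r, i)) * U $$ (p r, k))"
      by (intro sum.cong) (simp_all add: c1)
    also have "\<dots> = (\<Sum>r<d. cnj (U $$ (r, i)) * U $$ (r, k))"
      using sum.permute[OF p, of "\<lambda>r. cnj (U $$ (r, i)) * U $$ (r, k)"] by (simp add: o_def)
    finally show ?thesis .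
  qed
  moreover have "monomial_mat d p c * U \<in> carrier_mat d d"
    by (rule mult_carrier_mat[OF monomial_mat_carrier Uc])
  ultimately show ?thesis using U by (simp add: unitary_group_iff)
qed

lemma one_mat_unitary: "1\<^sub>m d \<in> unitary_group d"
proof -
  have "(\<Sum>r<d. cnj (1\<^sub>m d $$ (r, i)) * 1\<^sub>m d $$ (r, k)) = (if i = k then 1 else (0::complex))"
    if "i < d" "k < d" for i k
  proof -
    have "(\<Sum>r<d. cnj (1\<^sub>m d $$ (r, i)) * 1\<^sub>m d $$ (r, k)) =
        (\<Sum>r<d. if r = i then (if i = k then 1 else 0) else (0::complex))"
      using that by (intro sum.cong) auto
    then show ?thesis using that by simp
  qed
  then show ?thesis by (simp add: unitary_group_iff)
qed

lemma monomial_mat_unitary: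
  assumes p: "p permutes {..<d}" and c: "\<And>i. i < d \<Longrightarrow> norm (c i) = 1"
  shows "monomial_mat d p c \<in> unitary_group d"
proof -
  have "monomial_mat d p c * 1\<^sub>m d = monomial_mat d p c"
    by (rule right_mult_one_mat[OF monomial_mat_carrier])
  then show ?thesis
    using monomial_mat_mult_unitary[where c = c, OF p _ one_mat_unitary] c by simp
qed

abbreviation mat_minor :: "complex mat \<Rightarrow> nat set \<Rightarrow> nat set \<Rightarrow> complex" where
  "mat_minor U \<equiv> minor (\<lambda>i k. U $$ (i, k))"

lemma minor_scale_rows: "minor (\<lambda>i k. c i * A i k) S T = (\<Prod>i\<in>S. c i) * minor A S T"
  by (simp add: minor_def sum_distrib_left prod.distrib mult.left_commute)

lemma mat_minor_monomial_mult:
  assumes p: "p permutes {..<d}" and U: "U \<in> carrier_mat d d" and ST: "S \<subseteq> {..<d}" "T \<subseteq> {..<d}"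
  shows "mat_minor (monomial_mat d p c * U) S T =
     (\<Prod>i\<in>S. c i) * (of_int (inversion_sign S p) * mat_minor U (p ` S) T)"
proof -
  have "mat_minor (monomial_mat d p c * U) S T = minor (\<lambda>i k. c i * U $$ (p i, k)) S T"
    using ST by (intro minor_cong monomial_mat_mult_index[OF p U]) auto
  then show ?thesis
    using minor_permute_rows[of p S "\<lambda>i k. U $$ (i, k)" T] permutes_inj_on[OF p]
    by (simp add: minor_scale_rows)
qed

text \<open>Cauchy--Binet for \<open>U\<^sup>* U = 1\<close>: the compound matrix formed by the
  minors inherits orthonormal columns. Row sets \<open>R\<close> of the wrong size contribute
  zero.\<close>

lemma unitary_minor_sum:
  assumes U: "U \<in> unitary_group d" and T: "T \<subseteq> {..<d}" "T' \<subseteq> {..<d}"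
  shows "(\<Sum>R\<in>Pow {..<d}. mat_minor U R T * cnj (mat_minor U R T')) = (if T = T' then 1 else 0)"
proof -
  have fin: "finite T" "finite T'" using T finite_subset by auto
  have "(\<Sum>R\<in>Pow {..<d}. mat_minor U R T * cnj (mat_minor U R T')) =
      (\<Sum>R\<in>Pow {..<d}. minor (\<lambda>i r. cnj (U $$ (r, i))) T' R * mat_minor U R T)"
    by (intro sum.cong refl) (simp add: cnj_minor minor_transpose[of "\<lambda>i k. cnj (U $$ (i, k))"])
  also have "\<dots> = minor (\<lambda>i k. \<Sum>r<d. cnj (U $$ (r, i)) * U $$ (r, k)) T' T"
    using fin by (intro minor_mult[symmetric]) auto
  also have "\<dots> = minor (\<lambda>i k. if i = k then 1 else 0) T' T"
  proof (rule minor_cong)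
    fix i k assume "i \<in> T'" "k \<in> T"
    then have "i < d" "k < d" using T by auto
    then show "(\<Sum>r<d. cnj (U $$ (r, i)) * U $$ (r, k)) = (if i = k then 1 else 0)"
      using U by (simp add: unitary_group_iff)
  qed
  also have "\<dots> = (if T = T' then 1 else 0)" using fin by (simp add: minor_identity eq_commute)
  finally show ?thesis .
qed

text \<open>A bijection from \<open>S\<close> to \<open>R\<close> is glued with one between the
  complements, which have equal size as well.\<close>

lemma permutes_image_exists:
  assumes "finite N" "S \<subseteq> N" "R \<subseteq> N" "card S = card R"
  obtains p where "p permutes N" "p ` S = R"
proof -
  have fin: "finite S" "finite R" using assms finite_subset by auto
  obtain f where f: "bij_betw f S R" using assms fin finite_same_card_bij by blast
  have "card (N - S) = card (N - R)" using assms fin by (simp add: card_Diff_subset)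
  then obtain g where g: "bij_betw g (N - S) (N - R)"
    using assms finite_same_card_bij finite_Diff by metis
  define p where "p i = (if i \<in> S then f i else if i \<in> N then g i else i)" for i
  have 1: "bij_betw p S R" using f by (subst bij_betw_cong[of _ _ f]) (auto simp: p_def)
  have 2: "bij_betw p (N - S) (N - R)" using g by (subst bij_betw_cong[of _ _ g]) (auto simp: p_def)
  have "bij_betw p (S \<union> (N - S)) (R \<union> (N - R))"
    using bij_betw_combine[OF 1 2] by auto
  then have "bij_betw p N N" using assms by (simp add: Un_absorb1)
  then have "p permutes N" using assms by (intro bij_imp_permutes) (auto simp: p_def)
  moreover have "p ` S = R" using 1 by (simp add: bij_betw_def)
  ultimately show thesis using that by blast
qed

section \<open>Integration against Haar measure\<close>

locale unitary_haar = prob_space M for M :: "complex mat measure" +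
  fixes d :: nat
  assumes haar: "haar_prob d M"
begin

lemma sets_haar: "sets M = sets (borel_unitary d)"
  using haar by (simp add: haar_prob_def)

lemma space_haar: "space M = unitary_group d"
  using sets_eq_imp_space_eq[OF sets_haar] by (simp add: borel_unitary_def)

lemma entry_measurable:
  assumes "i < d" "k < d"
  shows "(\<lambda>U. U $$ (i, k)) \<in> borel_measurable M"
proof -
  have "entries d \<in> borel_unitary d \<rightarrow>\<^sub>M borel"
    unfolding borel_unitary_def by (rule measurable_vimage_algebra1) simp
  then have "entries d \<in> M \<rightarrow>\<^sub>M borel"
    using measurable_cong_sets[OF sets_haar refl] by blast
  moreover have "(\<lambda>f::nat \<times> nat \<Rightarrow> complex. f (i, k)) \<in> borel_measurable borel"
    by (intro borel_measurable_continuous_onI) simp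
  ultimately have "(\<lambda>U. entries d U (i, k)) \<in> borel_measurable M"
    by (rule measurable_compose)
  then show ?thesis using assms by (simp add: entries_def)
qed

lemma mat_minor_measurable:
  assumes "S \<subseteq> {..<d}" "T \<subseteq> {..<d}"
  shows "(\<lambda>U. mat_minor U S T) \<in> borel_measurable M"
  unfolding minor_def
  using assms
  by (intro borel_measurable_sum borel_measurable_times borel_measurable_const borel_measurable_prod
      entry_measurable) (auto simp: bijections_eq)

text \<open>The sigma-algebra is pulled back along \<open>entries\<close>, so it suffices that each
  entry of the product is measurable, and such an entry is a multiple of an entry of
  \<open>U\<close>.\<close>

lemma monomial_mult_measurable:
  assumes p: "p permutes {..<d}" and c: "\<And>i. i < d \<Longrightarrow> norm (c i) = 1"
  shows "(\<lambda>U. monomial_mat d p c * U) \<in> M \<rightarrow>\<^sub>M M"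
proof -
  let ?V = "monomial_mat d p c"
  have "(\<lambda>U. entries d (?V * U)) \<in> borel_measurable M"
  \<comment> \<open>The coordinates range over all of \<open>nat \<times> nat\<close>; those outside
    the matrix are constantly 0.\<close>
  proof (rule measurable_coordinatewise_then_product)
    fix ik :: "nat \<times> nat"
    obtain i k where ik: "ik = (i, k)" by force
    show "(\<lambda>U. entries d (?V * U) ik) \<in> borel_measurable M"
    proof (cases "i < d \<and> k < d")
      case True
      then have "p i < d" using p by (metis lessThan_iff permutes_in_image)
      have "(\<lambda>U. c i * U $$ (p i, k)) \<in> borel_measurable M"
        using True \<open>p i < d\<close> by (intro borel_measurable_times entry_measurable) auto
      moreover have "entries d (?V * U) ik = c i * U $$ (p i, k)" if "U \<in> space M" for U
        using True that by (simp add: ik entries_def space_haar unitary_group_def monomial_mat_mult_index[OF p])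
      ultimately show ?thesis by (simp cong: measurable_cong)
    next
      case False
      then have "entries d (?V * U) ik = 0" for U by (auto simp: ik entries_def)
      then show ?thesis by simp
    qed
  qed
  then have "(\<lambda>U. ?V * U) \<in> M \<rightarrow>\<^sub>M borel_unitary d"
    unfolding borel_unitary_def using monomial_mat_mult_unitary[OF p c]
    by (intro measurable_vimage_algebra2) (auto simp: space_haar)
  then show ?thesis using measurable_cong_sets[OF refl sets_haar] by blast
qed

lemma integral_monomial_mult:
  fixes f :: "complex mat \<Rightarrow> complex"
  assumes p: "p permutes {..<d}" and c: "\<And>i. i < d \<Longrightarrow> norm (c i) = 1"
    and f: "f \<in> borel_measurable M"
  shows "(\<integral>U. f (monomial_mat d p c * U) \<partial>M) = (\<integral>U. f U \<partial>M)"
proof -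
  have "(\<integral>U. f U \<partial>M) = (\<integral>U. f U \<partial>distr M M (\<lambda>U. monomial_mat d p c * U))"
    using haar monomial_mat_unitary[OF p c] by (simp add: haar_prob_def)
  also have "\<dots> = (\<integral>U. f (monomial_mat d p c * U) \<partial>M)"
    by (rule integral_distr[OF monomial_mult_measurable[OF p c] f])
  finally show ?thesis by simp
qed

lemma mat_minor_le:
  assumes "U \<in> space M" "S \<subseteq> {..<d}" "T \<subseteq> {..<d}"
  shows "norm (mat_minor U S T) \<le> card (bijections S T)"
  using norm_minor_le[of S T "\<lambda>i k. U $$ (i, k)" 1] assms
  by (auto simp: space_haar intro!: unitary_group_entry_le_1)

lemma integrable_mat_minor_product:
  assumes "S \<subseteq> {..<d}" "T \<subseteq> {..<d}" "S' \<subseteq> {..<d}" "T' \<subseteq> {..<d}"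
  shows "integrable M (\<lambda>U. mat_minor U S T * cnj (mat_minor U S' T'))"
proof (rule integrable_const_bound)
  show "AE U in M. norm (mat_minor U S T * cnj (mat_minor U S' T')) \<le>
      real (card (bijections S T)) * real (card (bijections S' T'))"
    using assms by (intro AE_I2) (auto simp: norm_mult intro!: mult_mono mat_minor_le)
  show "(\<lambda>U. mat_minor U S T * cnj (mat_minor U S' T')) \<in> borel_measurable M"
    using assms
    by (intro borel_measurable_times borel_measurable_continuous_on[where f = cnj] mat_minor_measurable)
      (auto intro: continuous_intros)
qed

text \<open>Left multiplication by diagonal sign matrices kills the integral for different row sets,
  and left multiplication by permutation matrices makes it independent of a common row set;
  its value is then found by summing over all row sets (Cauchy--Binet for \<open>U\<^sup>* U = 1\<close>).\<close>

lemma integral_mat_minor_product: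
  assumes S: "S \<subseteq> {..<d}" "S' \<subseteq> {..<d}" and T: "T \<subseteq> {..<d}" "T' \<subseteq> {..<d}"
  shows "(\<integral>U. mat_minor U S T * cnj (mat_minor U S' T') \<partial>M) =
    (if S = S' \<and> T = T' \<and> card S = card T then 1 / of_nat (d choose card S) else 0)"
proof -
  let ?f = "\<lambda>S S' U. mat_minor U S T * cnj (mat_minor U S' T')"
  have meas: "?f S S' \<in> borel_measurable M" if "S \<subseteq> {..<d}" "S' \<subseteq> {..<d}" for S S'
    using integrable_mat_minor_product[OF that(1) T(1) that(2) T(2)] by (rule borel_measurable_integrable)
  consider "S \<noteq> S'" | "S = S'" "card S \<noteq> card T" | "S = S'" "card S = card T" by blast
  then show ?thesis
  proof cases
    case 1
    then obtain r where r: "r \<in> S \<longleftrightarrow> r \<notin> S'" by blast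
    \<comment> \<open>The index \<open>r\<close> lies in exactly one of \<open>S\<close> and
      \<open>S'\<close>, so negating row \<open>r\<close> changes the sign of exactly one of the two
      minors.\<close>
    let ?c = "\<lambda>i. if i = r then -1 else (1::complex)"
    have fin: "finite S" "finite S'" using S finite_subset by auto
    have c: "norm (?c i) = 1" for i by simp
    have prod: "(\<Prod>i\<in>S. ?c i) * (\<Prod>i\<in>S'. ?c i) = -1"
      using r fin by (auto simp: prod.delta)
    have "(\<integral>U. ?f S S' U \<partial>M) = (\<integral>U. ?f S S' (monomial_mat d id ?c * U) \<partial>M)"
      by (rule integral_monomial_mult[symmetric, OF permutes_id c meas[OF S]])
    also have "\<dots> = (\<integral>U. - ?f S S' U \<partial>M)"
    proof (rule Bochner_Integration.integral_cong[OF refl])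
      fix U assume "U \<in> space M"
      then have U: "U \<in> carrier_mat d d" by (simp add: space_haar unitary_group_def)
      have "?f S S' (monomial_mat d id ?c * U) =
          ((\<Prod>i\<in>S. ?c i) * (\<Prod>i\<in>S'. ?c i)) * ?f S S' U"
        by (simp add: mat_minor_monomial_mult[OF permutes_id U] S T mult_ac if_distrib cong: if_cong)
      then show "?f S S' (monomial_mat d id ?c * U) = - ?f S S' U" unfolding prod by simp
    qed
    also have "\<dots> = - (\<integral>U. ?f S S' U \<partial>M)" by simp
    finally have "(\<integral>U. ?f S S' U \<partial>M) = 0" by (rule eq_neg_self_imp_zero)
    then show ?thesis using 1 by simp
  next
    case 2
    then show ?thesis by (simp add: minor_card_neq)
  next
    case 3
    have const: "(\<integral>U. ?f R R U \<partial>M) = (\<integral>U. ?f S S U \<partial>M)"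
      if R: "R \<subseteq> {..<d}" "card R = card S" for R
    proof -
      obtain p where p: "p permutes {..<d}" "p ` S = R"
        using permutes_image_exists[of "{..<d}" S R] R S by auto
      have "(\<integral>U. ?f S S U \<partial>M) = (\<integral>U. ?f S S (monomial_mat d p (\<lambda>_. 1) * U) \<partial>M)"
        by (rule integral_monomial_mult[symmetric, OF p(1) _ meas]) (use S in auto)
      also have "\<dots> = (\<integral>U. ?f R R U \<partial>M)"
      proof (rule Bochner_Integration.integral_cong[OF refl])
        fix U assume "U \<in> space M"
        then have U: "U \<in> carrier_mat d d" by (simp add: space_haar unitary_group_def)
        \<comment> \<open>The sign of \<open>p\<close> on \<open>S\<close> comes out of both minors
          and squares to 1.\<close>
        have "?f S S (monomial_mat d p (\<lambda>_. 1) * U) =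
          of_int (inversion_sign S p * inversion_sign S p) * ?f R R U"
          using p(2) by (simp only: mat_minor_monomial_mult[OF p(1) U S(1) T(1)]
            mat_minor_monomial_mult[OF p(1) U S(1) T(2)] of_int_mult complex_cnj_mult
            complex_cnj_of_int prod.neutral_const complex_cnj_one mult_1 mult_ac)
        then show "?f S S (monomial_mat d p (\<lambda>_. 1) * U) = ?f R R U" by simp
      qed
      finally show ?thesis by simp
    qed
    have "(if T = T' then 1 else 0) = (\<integral>U. (if T = T' then 1 else (0::complex)) \<partial>M)"
      by (simp add: prob_space)
    also have "\<dots> = (\<integral>U. (\<Sum>R\<in>Pow {..<d}. ?f R R U) \<partial>M)"
      using unitary_minor_sum[OF _ T]
      by (intro Bochner_Integration.integral_cong refl) (simp add: space_haar)
    also have "\<dots> = (\<Sum>R\<in>Pow {..<d}. (\<integral>U. ?f R R U \<partial>M))"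
      using T by (intro Bochner_Integration.integral_sum integrable_mat_minor_product) auto
    \<comment> \<open>The minors with column set \<open>T\<close> vanish unless
      \<open>card R = card T\<close>, which equals \<open>card S\<close> in this case.\<close>
    also have "\<dots> = (\<Sum>R | R \<subseteq> {..<d} \<and> card R = card S. (\<integral>U. ?f R R U \<partial>M))"
      using 3 by (intro sum.mono_neutral_right) (auto simp: minor_card_neq)
    also have "\<dots> = (\<Sum>R | R \<subseteq> {..<d} \<and> card R = card S. (\<integral>U. ?f S S U \<partial>M))"
      by (intro sum.cong refl const) auto
    also have "\<dots> = of_nat (d choose card S) * (\<integral>U. ?f S S U \<partial>M)"
      using n_subsets[of "{..<d}" "card S"] by simp
    finally have "of_nat (d choose card S) * (\<integral>U. ?f S S U \<partial>M) = (if T = T' then 1 else 0)" by simp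
    moreover have "card S \<le> d" using card_mono[OF _ S(1)] by simp
    then have "of_nat (d choose card S) \<noteq> (0::complex)" by simp
    ultimately show ?thesis using 3 by (cases "T = T'") (simp_all add: field_simps)
  qed
qed

end

section \<open>Linear pencils\<close>

lemma sum_Pow_card:
  fixes f :: "nat \<Rightarrow> 'a::comm_semiring_1"
  assumes "finite S"
  shows "(\<Sum>R\<in>Pow S. f (card R)) = (\<Sum>a\<le>card S. of_nat (card S choose a) * f a)"
proof -
  have "(\<Sum>R\<in>Pow S. f (card R)) = (\<Sum>a\<le>card S. \<Sum>R | R \<in> Pow S \<and> card R = a. f (card R))"
    using assms by (intro sum.group[symmetric]) (auto intro: card_mono)
  also have "\<dots> = (\<Sum>a\<le>card S. of_nat (card S choose a) * f a)"
  proof (rule sum.cong[OF refl])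
    fix a
    have "(\<Sum>R | R \<in> Pow S \<and> card R = a. f (card R)) = (\<Sum>R | R \<subseteq> S \<and> card R = a. f a)"
      by (rule sum.cong) auto
    then show "(\<Sum>R | R \<in> Pow S \<and> card R = a. f (card R)) = of_nat (card S choose a) * f a"
      using n_subsets[OF assms, of a] by simp
  qed
  finally show ?thesis .
qed

text \<open>The square arises because \<open>R\<close> and \<open>Q\<close> of the common size
  \<open>a\<close> are chosen independently of each other.\<close>

lemma sum_Pow_Pow_card:
  fixes f :: "nat \<Rightarrow> 'a::comm_semiring_1"
  assumes fin: "finite S" "finite T" and card: "card S = card T"
  shows "(\<Sum>R\<in>Pow S. \<Sum>Q\<in>Pow T. if card R = card Q then f (card R) else 0) =
    (\<Sum>a\<le>card S. (of_nat (card S choose a))\<^sup>2 * f a)"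
proof -
  have "(\<Sum>Q\<in>Pow T. if card R = card Q then f (card R) else 0) =
      of_nat (card S choose card R) * f (card R)" if "R \<in> Pow S" for R
  proof -
    have "card R \<le> card S" using that fin by (intro card_mono) auto
    have "(\<Sum>Q\<in>Pow T. if card R = card Q then f (card R) else 0) =
        (\<Sum>b\<le>card T. of_nat (card T choose b) * (if card R = b then f (card R) else 0))"
      by (rule sum_Pow_card[OF fin(2)])
    also have "\<dots> = (\<Sum>b\<le>card T. if b = card R then of_nat (card T choose b) * f (card R) else 0)"
      by (rule sum.cong) auto
    finally show ?thesis using \<open>card R \<le> card S\<close> card by simp
  qed
  then have "(\<Sum>R\<in>Pow S. \<Sum>Q\<in>Pow T. if card R = card Q then f (card R) else 0) =
      (\<Sum>R\<in>Pow S. of_nat (card S choose card R) * f (card R))" by (rule sum.cong[OF refl])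
  also have "\<dots> = (\<Sum>a\<le>card S. of_nat (card S choose a) * (of_nat (card S choose a) * f a))"
    by (rule sum_Pow_card[OF fin(1)])
  finally show ?thesis by (simp add: power2_eq_square mult.assoc)
qed

lemma integral_double_sum:
  fixes f :: "'i \<Rightarrow> 'k \<Rightarrow> 'a \<Rightarrow> 'b::{banach, second_countable_topology}"
  assumes "\<And>u v. u \<in> I \<Longrightarrow> v \<in> K \<Longrightarrow> integrable M (f u v)"
  shows "(\<integral>x. (\<Sum>u\<in>I. \<Sum>v\<in>K. f u v x) \<partial>M) = (\<Sum>u\<in>I. \<Sum>v\<in>K. (\<integral>x. f u v x \<partial>M))"
proof -
  have "(\<integral>x. (\<Sum>u\<in>I. \<Sum>v\<in>K. f u v x) \<partial>M) = (\<Sum>u\<in>I. (\<integral>x. (\<Sum>v\<in>K. f u v x) \<partial>M))"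
    by (intro Bochner_Integration.integral_sum Bochner_Integration.integrable_sum assms)
  also have "\<dots> = (\<Sum>u\<in>I. \<Sum>v\<in>K. (\<integral>x. f u v x \<partial>M))"
    by (intro sum.cong refl Bochner_Integration.integral_sum assms)
  finally show ?thesis .
qed

text \<open>The identity summand is left out and the index set is variable, so that the matrices can
  be added one at a time by induction on \<open>J\<close>.\<close>

definition pencil_sum :: "'g set \<Rightarrow> ('g \<Rightarrow> complex) \<Rightarrow> ('g \<Rightarrow> complex mat) \<Rightarrow> nat \<Rightarrow> nat \<Rightarrow> complex" where
  "pencil_sum J x U i k = (\<Sum>j\<in>J. x j * U j $$ (i, k))"

text \<open>Here \<open>u\<close> consists of the rows and columns assigned to the summand scaled by
  \<open>z\<close>; its minor contributes one factor \<open>z\<close> per row.\<close>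

definition laplace_coeff :: "complex \<Rightarrow> nat set \<Rightarrow> nat set \<Rightarrow> nat set \<times> nat set \<Rightarrow> complex" where
  "laplace_coeff z S T u =
     of_int (shuffle_sign (fst u) (S - fst u) * shuffle_sign (snd u) (T - snd u)) * z ^ card (fst u)"

lemma minor_add_scale:
  assumes "finite S" "finite T"
  shows "minor (\<lambda>i k. c * A i k + B i k) S T =
    (\<Sum>u\<in>Pow S \<times> Pow T. laplace_coeff c S T u * (minor A (fst u) (snd u) * minor B (S - fst u) (T - snd u)))"
  unfolding minor_add[OF assms] minor_scale sum.cartesian_product laplace_coeff_def
  by (intro sum.cong refl) (auto simp: mult_ac)

text \<open>The same random matrices enter both pencils. Four independent index sets allow the
  orthogonality of different minors to be carried through the induction.\<close>

definition product_moment ::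
  "complex mat measure \<Rightarrow> 'g set \<Rightarrow> ('g \<Rightarrow> complex) \<Rightarrow> ('g \<Rightarrow> complex) \<Rightarrow>
     nat set \<Rightarrow> nat set \<Rightarrow> nat set \<Rightarrow> nat set \<Rightarrow> complex" where
  "product_moment M J x y S T S' T' =
     (\<integral>U. minor (pencil_sum J x U) S T * cnj (minor (pencil_sum J y U) S' T') \<partial>(\<Pi>\<^sub>M j\<in>J. M))"

section \<open>Moments of pencil minors\<close>

context unitary_haar
begin

lemma product_prob: "prob_space (\<Pi>\<^sub>M j\<in>J. M)"
  by (rule prob_space_PiM) (rule prob_space_axioms)

lemma pencil_minor_measurable:
  assumes "S \<subseteq> {..<d}" "T \<subseteq> {..<d}"
  shows "(\<lambda>U. minor (pencil_sum J x U) S T) \<in> borel_measurable (\<Pi>\<^sub>M j\<in>J. M)"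
proof -
  have entry: "(\<lambda>U. U j $$ (i, k)) \<in> borel_measurable (\<Pi>\<^sub>M j\<in>J. M)" if "j \<in> J" "i < d" "k < d" for i j k
    using measurable_compose[OF measurable_component_singleton[OF that(1)] entry_measurable[OF that(2,3)]] .
  then show ?thesis
    unfolding minor_def pencil_sum_def
    using assms
    by (intro borel_measurable_sum borel_measurable_times borel_measurable_const borel_measurable_prod entry)
      (auto simp: bijections_eq)
qed

lemma pencil_minor_bounded:
  assumes "S \<subseteq> {..<d}" "T \<subseteq> {..<d}" and U: "U \<in> space (\<Pi>\<^sub>M j\<in>J. M)"
  shows "norm (minor (pencil_sum J x U) S T) \<le> card (bijections S T) * (\<Sum>j\<in>J. norm (x j)) ^ card S"
proof (rule norm_minor_le)
  fix i k assume "i \<in> S" "k \<in> T"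
  then have ik: "i < d" "k < d" using assms by auto
  have "norm (x j * U j $$ (i, k)) \<le> norm (x j)" if "j \<in> J" for j
  proof -
    have "U j \<in> unitary_group d" using U that by (auto simp: space_PiM space_haar PiE_iff)
    then show ?thesis
      using unitary_group_entry_le_1[OF _ ik] by (simp add: norm_mult mult_left_le)
  qed
  then show "norm (pencil_sum J x U i k) \<le> (\<Sum>j\<in>J. norm (x j))"
    unfolding pencil_sum_def by (rule sum_norm_le)
qed

lemma integrable_pencil_minor_product:
  assumes "S \<subseteq> {..<d}" "T \<subseteq> {..<d}" "S' \<subseteq> {..<d}" "T' \<subseteq> {..<d}"
  shows "integrable (\<Pi>\<^sub>M j\<in>J. M)
    (\<lambda>U. minor (pencil_sum J x U) S T * cnj (minor (pencil_sum J y U) S' T'))"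
proof -
  interpret P: prob_space "\<Pi>\<^sub>M j\<in>J. M" by (rule product_prob)
  show ?thesis
  proof (rule P.integrable_const_bound)
    show "AE U in (\<Pi>\<^sub>M j\<in>J. M). norm (minor (pencil_sum J x U) S T * cnj (minor (pencil_sum J y U) S' T')) \<le>
       (card (bijections S T) * (\<Sum>j\<in>J. norm (x j)) ^ card S) *
       (card (bijections S' T') * (\<Sum>j\<in>J. norm (y j)) ^ card S')"
      using assms
      by (intro AE_I2) (auto simp: norm_mult sum_nonneg intro!: mult_mono pencil_minor_bounded mult_nonneg_nonneg)
    show "(\<lambda>U. minor (pencil_sum J x U) S T * cnj (minor (pencil_sum J y U) S' T'))
        \<in> borel_measurable (\<Pi>\<^sub>M j\<in>J. M)"
      using assms
      by (intro borel_measurable_times borel_measurable_continuous_on[where f = cnj] pencil_minor_measurable)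
        (auto intro: continuous_intros)
  qed
qed

text \<open>Laplace expansion of both minors separates the matrix with index \<open>j\<close> from
  the others; by Fubini each term integrates to a product of a moment for one matrix and a moment
  for the pencil over \<open>J\<close>.\<close>

lemma product_moment_insert:
  fixes x y :: "'g \<Rightarrow> complex"
  assumes J: "finite J" "j \<notin> J"
    and sub: "S \<subseteq> {..<d}" "T \<subseteq> {..<d}" "S' \<subseteq> {..<d}" "T' \<subseteq> {..<d}"
  shows "product_moment M (insert j J) x y S T S' T' =
    (\<Sum>u\<in>Pow S \<times> Pow T. \<Sum>v\<in>Pow S' \<times> Pow T'. (laplace_coeff (x j) S T u * cnj (laplace_coeff (y j) S' T' v)) *
       ((\<integral>V. mat_minor V (fst u) (snd u) * cnj (mat_minor V (fst v) (snd v)) \<partial>M) *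
        product_moment M J x y (S - fst u) (T - snd u) (S' - fst v) (T' - snd v)))"
proof -
  interpret product_prob_space "\<lambda>_::'g. M" by (rule product_prob_spaceI) (rule prob_space_axioms)
  let ?I = "Pow S \<times> Pow T" and ?I' = "Pow S' \<times> Pow T'"
  let ?c = "\<lambda>u v. laplace_coeff (x j) S T u * cnj (laplace_coeff (y j) S' T' v)"
  let ?h = "\<lambda>u v V. mat_minor V (fst u) (snd u) * cnj (mat_minor V (fst v) (snd v))"
  let ?g = "\<lambda>u v U. minor (pencil_sum J x U) (S - fst u) (T - snd u) *
      cnj (minor (pencil_sum J y U) (S' - fst v) (T' - snd v))"
  have fin: "finite S" "finite T" "finite S'" "finite T'" using sub[THEN finite_subset] by simp_all
  \<comment> \<open>As \<open>j\<close> is not in \<open>J\<close>, replacing the matrix at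
    \<open>j\<close> by \<open>V\<close> leaves the pencil over \<open>J\<close> unchanged.\<close>
  have upd: "pencil_sum (insert j J) z (U(j := V)) = (\<lambda>i k. z j * V $$ (i, k) + pencil_sum J z U i k)"
    for z U V
    using J by (auto simp: pencil_sum_def fun_eq_iff intro!: sum.cong)
  have expand: "minor (pencil_sum (insert j J) x (U(j := V))) S T *
       cnj (minor (pencil_sum (insert j J) y (U(j := V))) S' T') =
      (\<Sum>u\<in>?I. \<Sum>v\<in>?I'. ?c u v * (?h u v V * ?g u v U))" for U V
    unfolding upd minor_add_scale[OF fin(1,2)] minor_add_scale[OF fin(3,4)] cnj_sum sum_product
    by (intro sum.cong refl) (simp only: complex_cnj_mult mult_ac)
  have h: "integrable M (?h u v)" if "u \<in> ?I" "v \<in> ?I'" for u v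
    using that sub by (intro integrable_mat_minor_product) auto
  have g: "integrable (\<Pi>\<^sub>M j\<in>J. M) (?g u v)" for u v
    using sub by (intro integrable_pencil_minor_product) auto
  have "product_moment M (insert j J) x y S T S' T' =
     (\<integral>U. (\<integral>V. (\<Sum>u\<in>?I. \<Sum>v\<in>?I'. ?c u v * (?h u v V * ?g u v U)) \<partial>M) \<partial>(\<Pi>\<^sub>M j\<in>J. M))"
    unfolding product_moment_def expand[symmetric]
    by (rule product_integral_insert[OF J]) (rule integrable_pencil_minor_product[OF sub])
  also have "\<dots> = (\<integral>U. (\<Sum>u\<in>?I. \<Sum>v\<in>?I'. ?c u v * ((\<integral>V. ?h u v V \<partial>M) * ?g u v U)) \<partial>(\<Pi>\<^sub>M j\<in>J. M))"
  proof (rule Bochner_Integration.integral_cong[OF refl])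
    fix U
    have "(\<integral>V. (\<Sum>u\<in>?I. \<Sum>v\<in>?I'. ?c u v * (?h u v V * ?g u v U)) \<partial>M) =
       (\<Sum>u\<in>?I. \<Sum>v\<in>?I'. (\<integral>V. ?c u v * (?h u v V * ?g u v U) \<partial>M))"
      by (intro integral_double_sum integrable_mult_right integrable_mult_left h)
    then show "(\<integral>V. (\<Sum>u\<in>?I. \<Sum>v\<in>?I'. ?c u v * (?h u v V * ?g u v U)) \<partial>M) =
       (\<Sum>u\<in>?I. \<Sum>v\<in>?I'. ?c u v * ((\<integral>V. ?h u v V \<partial>M) * ?g u v U))"
      by (simp only: integral_mult_right_zero integral_mult_left_zero)
  qed
  also have "\<dots> = (\<Sum>u\<in>?I. \<Sum>v\<in>?I'. (\<integral>U. ?c u v * ((\<integral>V. ?h u v V \<partial>M) * ?g u v U) \<partial>(\<Pi>\<^sub>M j\<in>J. M)))"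
    by (intro integral_double_sum integrable_mult_right g)
  finally show ?thesis by (simp only: integral_mult_right_zero product_moment_def)
qed

text \<open>The only row and column sets \<open>R\<close>, \<open>Q\<close>, \<open>R'\<close>, \<open>Q'\<close> contributing to the Laplace expansions are
  those with \<open>R = R'\<close> and \<open>Q = Q'\<close>, for which the shuffle signs cancel.\<close>

lemma product_moment_insert_diagonal:
  fixes c :: "nat \<Rightarrow> complex"
  assumes J: "finite J" "j \<notin> J"
    and c: "\<And>S T S' T'. S \<subseteq> {..<d} \<Longrightarrow> T \<subseteq> {..<d} \<Longrightarrow> S' \<subseteq> {..<d} \<Longrightarrow> T' \<subseteq> {..<d} \<Longrightarrow>
      product_moment M J x y S T S' T' = (if S = S' \<and> T = T' \<and> card S = card T then c (card S) else 0)"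
    and sub: "S \<subseteq> {..<d}" "T \<subseteq> {..<d}" "S' \<subseteq> {..<d}" "T' \<subseteq> {..<d}"
  shows "product_moment M (insert j J) x y S T S' T' =
    (if S = S' \<and> T = T' \<and> card S = card T then
       (\<Sum>a\<le>card S. (of_nat (card S choose a))\<^sup>2 *
         ((x j * cnj (y j)) ^ a / of_nat (d choose a) * c (card S - a))) else 0)"
proof -
  let ?t = "\<lambda>u v. (laplace_coeff (x j) S T u * cnj (laplace_coeff (y j) S' T' v)) *
       ((if fst u = fst v \<and> snd u = snd v \<and> card (fst u) = card (snd u)
          then 1 / of_nat (d choose card (fst u)) else 0) *
        (if S - fst u = S' - fst v \<and> T - snd u = T' - snd v \<and> card (S - fst u) = card (T - snd u)
          then c (card (S - fst u)) else 0))"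
  have fin: "finite S" "finite T" "finite S'" "finite T'" using sub[THEN finite_subset] by simp_all
  have moment: "product_moment M (insert j J) x y S T S' T' =
      (\<Sum>u\<in>Pow S \<times> Pow T. \<Sum>v\<in>Pow S' \<times> Pow T'. ?t u v)"
    unfolding product_moment_insert[OF J sub]
  proof (intro sum.cong refl)
    fix u v assume "u \<in> Pow S \<times> Pow T" "v \<in> Pow S' \<times> Pow T'"
    then have 1: "fst u \<subseteq> {..<d}" "snd u \<subseteq> {..<d}" "fst v \<subseteq> {..<d}" "snd v \<subseteq> {..<d}"
      using sub by auto
    have 2: "S - fst u \<subseteq> {..<d}" "T - snd u \<subseteq> {..<d}" "S' - fst v \<subseteq> {..<d}" "T' - snd v \<subseteq> {..<d}"
      using sub by auto
    show "(laplace_coeff (x j) S T u * cnj (laplace_coeff (y j) S' T' v)) *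
       ((\<integral>V. mat_minor V (fst u) (snd u) * cnj (mat_minor V (fst v) (snd v)) \<partial>M) *
        product_moment M J x y (S - fst u) (T - snd u) (S' - fst v) (T' - snd v)) = ?t u v"
      unfolding integral_mat_minor_product[OF 1(1,3,2,4)] c[OF 2] ..
  qed
  show ?thesis
  proof (cases "S = S' \<and> T = T' \<and> card S = card T")
    case False
    \<comment> \<open>In a nonzero term the chosen blocks agree, and so do their complements.
      Reassembling them gives \<open>S = S'\<close>, \<open>T = T'\<close> and
      \<open>card S = card T\<close>.\<close>
    have "?t u v = 0" if u: "u \<in> Pow S \<times> Pow T" and v: "v \<in> Pow S' \<times> Pow T'" for u v
    proof (rule ccontr)
      assume "?t u v \<noteq> 0"
      then have *: "fst u = fst v" "snd u = snd v" "card (fst u) = card (snd u)"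
        "S - fst u = S' - fst v" "T - snd u = T' - snd v" "card (S - fst u) = card (T - snd u)"
        by (simp_all split: if_splits)
      have "S = S'" using arg_cong2[of _ _ _ _ "(\<union>)", OF *(1,4)] u v by (auto simp: Un_absorb1)
      moreover have "T = T'" using arg_cong2[of _ _ _ _ "(\<union>)", OF *(2,5)] u v by (auto simp: Un_absorb1)
      moreover have "card S = card (fst u) + card (S - fst u)" "card T = card (snd u) + card (T - snd u)"
        using u fin by (auto simp: card_Diff_subset finite_subset card_mono)
      ultimately show False using False * by simp
    qed
    then show ?thesis using False unfolding moment by (simp only: if_False sum.neutral_const cong: sum.cong)
  next
    case True
    let ?F = "\<lambda>a. (x j * cnj (y j)) ^ a / of_nat (d choose a) * c (card S - a)"
    have "?t u v = (if v = u then if card (fst u) = card (snd u) then ?F (card (fst u)) else 0 else 0)"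
      if u: "u \<in> Pow S \<times> Pow T" for u v
    proof (cases "v = u \<and> card (fst u) = card (snd u)")
      case eq: True
      have cards: "card (S - fst u) = card S - card (fst u)" "card (T - snd u) = card T - card (snd u)"
        using u fin by (auto simp: card_Diff_subset finite_subset)
      have *: "card (S - fst u) = card (T - snd u)" unfolding cards using True eq by metis
      have "?t u v = (laplace_coeff (x j) S T u * cnj (laplace_coeff (y j) S T u)) *
          (1 / of_nat (d choose card (fst u)) * c (card (S - fst u)))"
        using True eq * by simp
      also have "laplace_coeff (x j) S T u * cnj (laplace_coeff (y j) S T u) =
          of_int (shuffle_sign (fst u) (S - fst u) * shuffle_sign (fst u) (S - fst u)) *
          of_int (shuffle_sign (snd u) (T - snd u) * shuffle_sign (snd u) (T - snd u)) *
          (x j * cnj (y j)) ^ card (fst u)"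
        by (simp only: laplace_coeff_def of_int_mult complex_cnj_mult complex_cnj_of_int complex_cnj_power
            power_mult_distrib mult_ac)
      finally show ?thesis using eq cards(1) by simp
    next
      case neq: False
      then show ?thesis by (auto simp: prod_eq_iff)
    qed
    then have "product_moment M (insert j J) x y S T S' T' =
      (\<Sum>u\<in>Pow S \<times> Pow T. \<Sum>v\<in>Pow S' \<times> Pow T'.
        if v = u then if card (fst u) = card (snd u) then ?F (card (fst u)) else 0 else 0)"
      unfolding moment by (intro sum.cong refl) blast
    also have "\<dots> = (\<Sum>u\<in>Pow S \<times> Pow T. if card (fst u) = card (snd u) then ?F (card (fst u)) else 0)"
      using True fin by (intro sum.cong refl) (simp add: sum.delta)
    also have "\<dots> = (\<Sum>R\<in>Pow S. \<Sum>Q\<in>Pow T. if card R = card Q then ?F (card R) else 0)"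
      by (simp add: sum.cartesian_product split_def)
    also have "\<dots> = (\<Sum>a\<le>card S. (of_nat (card S choose a))\<^sup>2 * ?F a)"
      using True fin by (intro sum_Pow_Pow_card) auto
    finally show ?thesis unfolding if_P[OF True] .
  qed
qed

end

section \<open>Behaviour of the moments for large \<open>d\<close>\<close>

lemma binomial_shift_ratio_tendsto:
  "(\<lambda>d. real (d - a choose k) / real (d choose k)) \<longlonglongrightarrow> 1"
proof -
  \<comment> \<open>The number \<open>k\<close> of factors is fixed, and each of them tends to
    1.\<close>
  have "((\<lambda>d. \<Prod>i<k. (real d - a - i) / (real d - i)) \<longlongrightarrow> (\<Prod>i<k. 1)) sequentially"
    by (intro tendsto_prod) real_asymp
  moreover have "eventually (\<lambda>d. (\<Prod>i<k. (real d - a - i) / (real d - i)) =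
      real (d - a choose k) / real (d choose k)) sequentially"
    \<comment> \<open>From \<open>a + k\<close> on, the subtraction \<open>d - a\<close> is not
      truncated and both binomial coefficients have their product form.\<close>
    using eventually_ge_at_top[of "a + k"]
  proof eventually_elim
    case (elim d)
    have "real (n choose k) = (\<Prod>i<k. (real n - i) / (real k - i))" if "k \<le> n" for n
      unfolding binomial_altdef_of_nat[OF that, where 'a = real] atLeast0LessThan
      by (intro prod.cong refl) (use that in \<open>simp add: of_nat_diff\<close>)
    then have "real (d - a choose k) = (\<Prod>i<k. (real d - a - i) / (real k - i))"
      "real (d choose k) = (\<Prod>i<k. (real d - i) / (real k - i))"
      using elim by (simp_all add: of_nat_diff)
    then show ?case by (simp flip: prod_dividef)
  qed
  ultimately show ?thesis by (simp add: tendsto_cong)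
qed

text \<open>Choosing \<open>m\<close> out of \<open>d\<close> and then \<open>a\<close> out of
  \<open>m\<close> equals choosing \<open>a\<close> out of \<open>d\<close> and then
  \<open>m - a\<close> from the rest. This cancels \<open>d choose a\<close> and one factor
  \<open>m choose a\<close>; the moment \<open>c\<close> is then renormalized by its own binomial
  coefficient.\<close>

lemma binomial_product_ratio:
  fixes z c :: complex
  assumes "a \<le> m" "m \<le> d"
  shows "of_nat (d choose m) * ((of_nat (m choose a))\<^sup>2 * (z / of_nat (d choose a) * c)) =
    of_nat (m choose a) * z * of_real (real (d - a choose (m - a)) / real (d choose (m - a))) *
      (of_nat (d choose (m - a)) * c)"
proof -
  have "complex_of_nat (d choose m) * of_nat (m choose a) = of_nat (d choose a) * of_nat (d - a choose (m - a))"
    using choose_mult[OF assms] by (simp flip: of_nat_mult)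
  moreover have "complex_of_nat (d choose a) \<noteq> 0" "complex_of_nat (d choose (m - a)) \<noteq> 0"
    using assms by auto
  ultimately show ?thesis by (simp add: field_simps power2_eq_square)
qed

text \<open>After multiplication with \<open>d choose m\<close>, the recursion of the second moments becomes the binomial
  recursion up to factors in \<open>[0, 1]\<close> which tend to 1.\<close>

lemma product_moment_asymptotics:
  fixes x y :: "'g \<Rightarrow> complex"
  assumes haar: "\<And>d. haar_prob d (haar d)" and J: "finite J"
  shows "\<exists>c :: nat \<Rightarrow> nat \<Rightarrow> complex.
    (\<forall>d S T S' T'. S \<subseteq> {..<d} \<longrightarrow> T \<subseteq> {..<d} \<longrightarrow> S' \<subseteq> {..<d} \<longrightarrow> T' \<subseteq> {..<d} \<longrightarrow>
      product_moment (haar d) J x y S T S' T' =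
        (if S = S' \<and> T = T' \<and> card S = card T then c d (card S) else 0)) \<and>
    (\<forall>d m. m \<le> d \<longrightarrow> norm (of_nat (d choose m) * c d m) \<le> (\<Sum>j\<in>J. norm (x j * cnj (y j))) ^ m) \<and>
    (\<forall>m. (\<lambda>d. of_nat (d choose m) * c d m) \<longlonglongrightarrow> (\<Sum>j\<in>J. x j * cnj (y j)) ^ m)"
  using J
proof (induction rule: finite_induct)
  case empty
  \<comment> \<open>Without matrices only the empty minor is nonzero. The moment is the
    \<open>m\<close>-th power of 0, with value 1 at \<open>m = 0\<close>, in agreement with the
    power of the empty sum.\<close>
  let ?c = "\<lambda>(d::nat) (m::nat). if m = 0 then 1 else (0::complex)"
  have "product_moment (haar d) {} x y S T S' T' =
      (if S = S' \<and> T = T' \<and> card S = card T then ?c d (card S) else 0)"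
    if sub: "S \<subseteq> {..<d}" "T \<subseteq> {..<d}" "S' \<subseteq> {..<d}" "T' \<subseteq> {..<d}" for d S T S' T'
  proof -
    have fin: "finite S" "finite T" "finite S'" "finite T'" using sub[THEN finite_subset] by simp_all
    have minor: "minor (pencil_sum {} z U) A B = (if A = {} \<and> B = {} then 1 else 0)"
      if "finite A" "finite B" for z :: "'g \<Rightarrow> complex" and U A B
    proof (cases "card A = card B")
      case True
      then show ?thesis using minor_zero[of A B, where 'a = complex] that by (simp add: pencil_sum_def[abs_def])
    next
      case False
      then show ?thesis by (auto simp: minor_card_neq)
    qed
    interpret P: prob_space "\<Pi>\<^sub>M j\<in>({}::'g set). haar d"
      by (rule prob_space_PiM) simp
    show ?thesis
      unfolding product_moment_def minor[OF fin(1,2)] minor[OF fin(3,4)]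
      using fin by (auto simp: P.prob_space)
  qed
  then show ?case by (intro exI[of _ ?c]) (auto simp: power_0_left)
next
  case (insert j J)
  let ?z = "x j * cnj (y j)" and ?s = "\<Sum>j\<in>J. norm (x j * cnj (y j))" and ?w = "\<Sum>j\<in>J. x j * cnj (y j)"
  from insert.IH obtain c where
    c: "\<And>d S T S' T'. S \<subseteq> {..<d} \<Longrightarrow> T \<subseteq> {..<d} \<Longrightarrow> S' \<subseteq> {..<d} \<Longrightarrow> T' \<subseteq> {..<d} \<Longrightarrow>
      product_moment (haar d) J x y S T S' T' =
        (if S = S' \<and> T = T' \<and> card S = card T then c d (card S) else 0)"
    and bound: "\<And>d m. m \<le> d \<Longrightarrow> norm (of_nat (d choose m) * c d m) \<le> ?s ^ m"
    and lim: "\<And>m. (\<lambda>d. of_nat (d choose m) * c d m) \<longlonglongrightarrow> ?w ^ m"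
    by blast
  \<comment> \<open>This is the recursion supplied by \<open>product_moment_insert_diagonal\<close>
    for one further matrix.\<close>
  define c' where "c' d m = (\<Sum>a\<le>m. (of_nat (m choose a))\<^sup>2 *
      (?z ^ a / of_nat (d choose a) * c d (m - a)))" for d m
  let ?r = "\<lambda>d m a. real (d - a choose (m - a)) / real (d choose (m - a))"
  have c'_eq: "of_nat (d choose m) * c' d m = (\<Sum>a\<le>m. of_nat (m choose a) * ?z ^ a *
      of_real (?r d m a) * (of_nat (d choose (m - a)) * c d (m - a)))" if "m \<le> d" for d m
    unfolding c'_def sum_distrib_left using that
    by (intro sum.cong refl binomial_product_ratio) auto
  have "product_moment (haar d) (insert j J) x y S T S' T' =
        (if S = S' \<and> T = T' \<and> card S = card T then c' d (card S) else 0)"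
    if "S \<subseteq> {..<d}" "T \<subseteq> {..<d}" "S' \<subseteq> {..<d}" "T' \<subseteq> {..<d}" for d S T S' T'
  proof -
    interpret unitary_haar "haar d" d
      using haar[of d] by (simp add: unitary_haar_def unitary_haar_axioms_def haar_prob_def)
    show ?thesis
      unfolding c'_def by (rule product_moment_insert_diagonal[OF insert.hyps c that])
  qed
  moreover have "norm (of_nat (d choose m) * c' d m) \<le> (\<Sum>j\<in>insert j J. norm (x j * cnj (y j))) ^ m"
    if "m \<le> d" for d m
  proof -
    have "norm (of_nat (d choose m) * c' d m) \<le> (\<Sum>a\<le>m. of_nat (m choose a) * norm ?z ^ a * ?s ^ (m - a))"
      unfolding c'_eq[OF that]
    proof (rule sum_norm_le)
      fix a assume a: "a \<in> {..m}"
      have "d - a choose (m - a) \<le> d choose (m - a)" by (rule binomial_right_mono) simp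
      then have "?r d m a \<le> 1" using that by (auto simp: divide_le_eq_1)
      moreover have "norm (of_nat (d choose (m - a)) * c d (m - a)) \<le> ?s ^ (m - a)"
        using that by (intro bound) simp
      ultimately have "?r d m a * norm (of_nat (d choose (m - a)) * c d (m - a)) \<le> 1 * ?s ^ (m - a)"
        by (intro mult_mono) auto
      then have "of_nat (m choose a) * norm ?z ^ a * (?r d m a * norm (of_nat (d choose (m - a)) * c d (m - a)))
          \<le> of_nat (m choose a) * norm ?z ^ a * ?s ^ (m - a)"
        by (intro mult_left_mono) auto
      moreover have "norm (of_nat (m choose a) * ?z ^ a * of_real (?r d m a) *
           (of_nat (d choose (m - a)) * c d (m - a))) =
          of_nat (m choose a) * norm ?z ^ a * (?r d m a * norm (of_nat (d choose (m - a)) * c d (m - a)))"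
        by (simp only: norm_mult norm_power norm_of_nat norm_of_real abs_divide abs_of_nat mult.assoc)
      ultimately show "norm (of_nat (m choose a) * ?z ^ a * of_real (?r d m a) *
           (of_nat (d choose (m - a)) * c d (m - a))) \<le> of_nat (m choose a) * norm ?z ^ a * ?s ^ (m - a)"
        by simp
    qed
    also have "\<dots> = (norm ?z + ?s) ^ m" by (rule binomial_ring[symmetric])
    finally show ?thesis using insert.hyps by simp
  qed
  moreover have "(\<lambda>d. of_nat (d choose m) * c' d m) \<longlonglongrightarrow> (\<Sum>j\<in>insert j J. x j * cnj (y j)) ^ m" for m
  proof -
    have "(\<lambda>d. \<Sum>a\<le>m. of_nat (m choose a) * ?z ^ a *
      of_real (?r d m a) * (of_nat (d choose (m - a)) * c d (m - a)))
      \<longlonglongrightarrow> (\<Sum>a\<le>m. of_nat (m choose a) * ?z ^ a * of_real 1 * ?w ^ (m - a))"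
      by (intro tendsto_sum tendsto_mult tendsto_const tendsto_of_real binomial_shift_ratio_tendsto lim)
    also have "(\<Sum>a\<le>m. of_nat (m choose a) * ?z ^ a * of_real 1 * ?w ^ (m - a)) = (?z + ?w) ^ m"
      by (simp add: binomial_ring)
    finally have lim': "(\<lambda>d. \<Sum>a\<le>m. of_nat (m choose a) * ?z ^ a *
      of_real (?r d m a) * (of_nat (d choose (m - a)) * c d (m - a))) \<longlonglongrightarrow> (?z + ?w) ^ m" .
    \<comment> \<open>The rewritten recursion is available for \<open>m \<le> d\<close> only, which
      holds for all large \<open>d\<close>.\<close>
    have "eventually (\<lambda>d. (\<Sum>a\<le>m. of_nat (m choose a) * ?z ^ a *
      of_real (?r d m a) * (of_nat (d choose (m - a)) * c d (m - a))) = of_nat (d choose m) * c' d m) sequentially"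
      using eventually_ge_at_top[of m] by eventually_elim (simp only: c'_eq)
    then have "(\<lambda>d. of_nat (d choose m) * c' d m) \<longlonglongrightarrow> (?z + ?w) ^ m"
      by (rule Lim_transform_eventually[OF lim'])
    then show ?thesis using insert.hyps by simp
  qed
  ultimately show ?case by (intro exI[of _ c']) blast
qed

section \<open>Determinants of linear pencils and the limit\<close>

lemma det_linear_pencil:
  "Determinant.det (linear_pencil d x U) = (\<Sum>S\<in>Pow {..<d}. minor (pencil_sum UNIV (($) x) U) S S)"
proof -
  have "Determinant.det (linear_pencil d x U) =
      minor (\<lambda>i k. linear_pencil d x U $$ (i, k)) {..<d} {..<d}"
    by (rule det_eq_minor) (simp add: linear_pencil_def)
  also have "\<dots> = minor (\<lambda>i k. (if i = k then 1 else 0) + pencil_sum UNIV (($) x) U i k) {..<d} {..<d}"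
    by (rule minor_cong) (simp add: linear_pencil_def pencil_sum_def)
  also have "\<dots> = (\<Sum>S\<in>Pow {..<d}. minor (pencil_sum UNIV (($) x) U) S S)"
    by (rule minor_add_identity) simp
  finally show ?thesis .
qed

text \<open>Principal minors on different index sets are orthogonal, so the double sum collapses to
  its diagonal, where each size \<open>m\<close> occurs \<open>d choose m\<close> times.\<close>

lemma (in unitary_haar) integral_det_linear_pencil:
  fixes x y :: "complex ^ 'g" and c :: "nat \<Rightarrow> complex"
  assumes c: "\<And>S T S' T'. S \<subseteq> {..<d} \<Longrightarrow> T \<subseteq> {..<d} \<Longrightarrow> S' \<subseteq> {..<d} \<Longrightarrow> T' \<subseteq> {..<d} \<Longrightarrow>
      product_moment M UNIV (($) x) (($) y) S T S' T' =
        (if S = S' \<and> T = T' \<and> card S = card T then c (card S) else 0)"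
  shows "(\<integral>U. Determinant.det (linear_pencil d x U) * cnj (Determinant.det (linear_pencil d y U))
       \<partial>(\<Pi>\<^sub>M j\<in>UNIV. M)) = (\<Sum>m\<le>d. of_nat (d choose m) * c m)"
proof -
  let ?N = "Pow {..<d}"
  let ?f = "\<lambda>S T U. minor (pencil_sum UNIV (($) x) U) S S * cnj (minor (pencil_sum UNIV (($) y) U) T T)"
  have int: "integrable (\<Pi>\<^sub>M j\<in>UNIV. M) (?f S T)" if "S \<in> ?N" "T \<in> ?N" for S T
    using that by (intro integrable_pencil_minor_product) auto
  have "(\<integral>U. Determinant.det (linear_pencil d x U) * cnj (Determinant.det (linear_pencil d y U))
       \<partial>(\<Pi>\<^sub>M j\<in>UNIV. M)) = (\<integral>U. (\<Sum>S\<in>?N. \<Sum>T\<in>?N. ?f S T U) \<partial>(\<Pi>\<^sub>M j\<in>UNIV. M))"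
    unfolding det_linear_pencil cnj_sum sum_product ..
  also have "\<dots> = (\<Sum>S\<in>?N. \<Sum>T\<in>?N. product_moment M UNIV (($) x) (($) y) S S T T)"
    unfolding product_moment_def
    by (rule integral_double_sum) (rule int)
  also have "\<dots> = (\<Sum>S\<in>?N. \<Sum>T\<in>?N. if T = S then c (card S) else 0)"
    by (intro sum.cong refl) (auto simp: c)
  also have "\<dots> = (\<Sum>S\<in>?N. c (card S))" by simp
  also have "\<dots> = (\<Sum>m\<le>d. of_nat (d choose m) * c m)"
    using sum_Pow_card[of "{..<d}" c] by simp
  finally show ?thesis .
qed

theorem corollary1p2:
  fixes x y :: "complex ^ 'g"
    and haar :: "nat \<Rightarrow> complex mat measure"
  assumes "\<And>d. haar_prob d (haar d)"
    and "norm x < 1" and "norm y < 1"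
  shows "(\<lambda>d. \<integral>U. Determinant.det (linear_pencil d x U) *
                  cnj (Determinant.det (linear_pencil d y U))
               \<partial>(\<Pi>\<^sub>M j\<in>UNIV. haar d))
           \<longlonglongrightarrow> 1 / (1 - cinner x y)"
proof -
  let ?s = "\<Sum>j\<in>UNIV. norm (x $ j * cnj (y $ j))"
  obtain c where
    c: "\<And>d S T S' T'. S \<subseteq> {..<d} \<Longrightarrow> T \<subseteq> {..<d} \<Longrightarrow> S' \<subseteq> {..<d} \<Longrightarrow> T' \<subseteq> {..<d} \<Longrightarrow>
      product_moment (haar d) UNIV (($) x) (($) y) S T S' T' =
        (if S = S' \<and> T = T' \<and> card S = card T then c d (card S) else 0)"
    and bound: "\<And>d m. m \<le> d \<Longrightarrow> norm (of_nat (d choose m) * c d m) \<le> ?s ^ m"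
    and lim: "\<And>m. (\<lambda>d. of_nat (d choose m) * c d m) \<longlonglongrightarrow> cinner x y ^ m"
    using product_moment_asymptotics[OF assms(1), of UNIV "($) x" "($) y"]
    unfolding cinner_def by (auto simp: finite)
  \<comment> \<open>Extending the terms by 0 beyond \<open>d\<close> turns the finite sums into
    series over a range independent of \<open>d\<close>, as Tannery's theorem requires.\<close>
  let ?a = "\<lambda>m d. if m \<le> d then of_nat (d choose m) * c d m else 0"
  have "(\<integral>U. Determinant.det (linear_pencil d x U) * cnj (Determinant.det (linear_pencil d y U))
       \<partial>(\<Pi>\<^sub>M j\<in>UNIV. haar d)) = (\<Sum>m. ?a m d)" for d
  proof -
    interpret unitary_haar "haar d" d
      using assms(1)[of d] by (simp add: unitary_haar_def unitary_haar_axioms_def haar_prob_def)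
    have "(\<Sum>m. ?a m d) = (\<Sum>m\<le>d. ?a m d)" by (rule suminf_finite) auto
    then show ?thesis using integral_det_linear_pencil[OF c] by simp
  qed
  moreover have s: "0 \<le> ?s" "?s < 1"
  proof -
    \<comment> \<open>The absolute values prepare for the Cauchy--Schwarz inequality, which bounds
      the ratio of the dominating geometric series by \<open>norm x * norm y\<close>.\<close>
    have "?s = (\<Sum>j\<in>UNIV. \<bar>norm (x $ j)\<bar> * \<bar>norm (y $ j)\<bar>)" by (simp add: norm_mult)
    also have "\<dots> \<le> norm x * norm y" unfolding norm_vec_def by (rule L2_set_mult_ineq)
    also have "\<dots> \<le> norm x * 1" using assms(3) by (intro mult_left_mono) auto
    also have "\<dots> < 1" using assms(2) by simp
    finally show "?s < 1" .
  qed (simp add: sum_nonneg)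
  moreover have "(\<lambda>d. \<Sum>m. ?a m d) \<longlonglongrightarrow> (\<Sum>m. cinner x y ^ m)"
  proof -
    have "norm (?a m d) \<le> ?s ^ m" for m d using bound[of m d] s(1) by simp
    moreover have "(\<lambda>d. ?a m d) \<longlonglongrightarrow> cinner x y ^ m" for m
      \<comment> \<open>For fixed \<open>m\<close> the extension by 0 has no effect once
        \<open>d \<ge> m\<close>.\<close>
      by (rule Lim_transform_eventually[OF lim eventually_mono[OF eventually_ge_at_top[of m]]]) simp
    moreover have "summable (\<lambda>m. ?s ^ m)" using s by (intro summable_geometric) simp
    ultimately show ?thesis
      using tannerys_theorem[of ?a "\<lambda>m. cinner x y ^ m" sequentially "\<lambda>m. ?s ^ m"] by (simp add: split_def)
  qed
  moreover have "norm (cinner x y) < 1"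
    using norm_sum[of "\<lambda>j. x $ j * cnj (y $ j)" UNIV] s(2) unfolding cinner_def by simp
  ultimately show ?thesis by (simp add: suminf_geometric)
qed

end
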